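(* Let $(\mathsf G,\mathcal G,\nu)$ be a probability space and let $\varpi$, $c$, $\pi$, $\mathsf T$, $\mathsf G(t)$, $m$, $\nu_t$ be as in the context. Let $M$ be the independent Metropolis kernel and $U$ the ideal slice sampling kernel defined in the context. For $t\in\mathsf T$ let the Markov kernel $H_t$ on $\mathsf G(t)$ be given by $$H_t(x,A)=\nu(A\cap\mathsf G(t))+\mathbf 1_A(x)\,(1-\nu(\mathsf G(t))),\qquad x\in\mathsf G(t),\ A\in\mathcal G.$$ Then each $H_t$ satisfies a weak Poincaré inequality (on $\mathsf G(t)$ with measure $\nu_t$) with respect to $\widetilde\beta(\cdot,t)$, where $\widetilde\beta(s,t)=\frac14\mathbf 1_{(0,m(t)^{-1})}(s)$. Consequently, for all $s>0$ and $f\in\mathrm L^2_0(\pi)$, $$\mathcal E_\pi(M,f)\le\mathcal E_\pi(U,f)\le s\,\mathcal E_\pi(M,f)+\frac{\|f\|^2_{\mathrm{osc},\pi}}{4c}\int_{\mathsf T}\mathbf 1_{(0,m(t)^{-1})}(s)\,m(t)\,\mathrm dt .$$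
   Context: Setting: $\varpi:\mathsf G\to(0,\infty)$ is measurable with $c:=\int_{\mathsf G}\varpi\,\mathrm d\nu\in(0,\infty)$; $\pi(\mathrm dx)=c^{-1}\varpi(x)\,\nu(\mathrm dx)$. It is assumed that the supremum $\|\varpi\|_\infty$ (possibly $+\infty$) equals the $\nu$-essential supremum of $\varpi$. Let $\mathsf T:=(0,\|\varpi\|_\infty)$ and, for $t\in\mathsf T$, $\mathsf G(t):=\{x\in\mathsf G:\varpi(x)>t\}$, $m(t):=\nu(\mathsf G(t))$, $\nu_t(A):=\nu(A\cap\mathsf G(t))/m(t)$ for $A\in\mathcal G$. Ideal slice sampling kernel: $U(x,A)=\frac1{\varpi(x)}\int_0^{\varpi(x)}\nu_t(A)\,\mathrm dt$. Independent Metropolis kernel: $M(x,A)=\int_A a(x,y)\,\nu(\mathrm dy)+\mathbf 1_A(x)\bigl(1-\int_{\mathsf G}a(x,y)\,\nu(\mathrm dy)\bigr)$ with $a(x,y)=\min\{1,\varpi(y)/\varpi(x)\}$. For a probability measure $\mu$: $\mathrm L^2(\mu)$ has inner product $\langle f,g\rangle_\mu=\mu(fg)$ and norm $\|\cdot\|_\mu$; $\mathrm L^2_0(\mu)=\{f\in\mathrm L^2(\mu):\mu(f)=0\}$; $\|f\|_{\mathrm{osc},\mu}:=\operatorname{ess\,sup}_\mu f-\operatorname{ess\,inf}_\mu f\in[0,\infty]$, with the convention $0\cdot\infty=0$. A Markov kernel $P$ is $\mu$-reversible if $\mu(\mathrm dx)P(x,\mathrm dy)$ is symmetric; it acts by $\mathrm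 Pf(x)=\int f(y)P(x,\mathrm dy)$ and is positive if $\langle\mathrm Pf,f\rangle_\mu\ge0$ for all $f\in\mathrm L^2(\mu)$. Dirichlet form: $\mathcal E_\mu(P,f)=\langle(\mathrm{Id}-\mathrm P)f,f\rangle_\mu=\frac12\iint[f(x)-f(y)]^2P(x,\mathrm dy)\mu(\mathrm dx)$. Weak Poincaré inequality (WPI): $P$ satisfies a WPI with respect to $b:(0,\infty)\to[0,\infty)$ (and the probability measure $\mu$) if $b$ is decreasing (non-strictly) with $\lim_{s\to\infty}b(s)=0$, $P$ is $\mu$-reversible and positive, and $\|f\|_\mu^2\le s\,\mathcal E_\mu(P,f)+b(s)\|f\|_{\mathrm{osc},\mu}^2$ for all $s>0$, $f\in\mathrm L^2_0(\mu)$. *)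

theory Defs
  imports "HOL-Probability.Probability" "HOL-Probability.Essential_Supremum"
begin

section \<open>Square-integrable functions and oscillation\<close>

definition L2 :: "'a measure \<Rightarrow> ('a \<Rightarrow> real) set" where
  "L2 \<mu> = {f \<in> borel_measurable \<mu>. integrable \<mu> (\<lambda>x. (f x)\<^sup>2)}"

definition L2_0 :: "'a measure \<Rightarrow> ('a \<Rightarrow> real) set" where
  "L2_0 \<mu> = {f \<in> L2 \<mu>. (\<integral>x. f x \<partial>\<mu>) = 0}"

definition L2_inner :: "'a measure \<Rightarrow> ('a \<Rightarrow> real) \<Rightarrow> ('a \<Rightarrow> real) \<Rightarrow> real" where
  "L2_inner \<mu> f g = (\<integral>x. f x * g x \<partial>\<mu>)"

definition L2_norm :: "'a measure \<Rightarrow> ('a \<Rightarrow> real) \<Rightarrow> real" where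
  "L2_norm \<mu> f = sqrt (L2_inner \<mu> f f)"

text \<open>The counterpart of \<^const>\<open>esssup\<close>, which the library defines as the upper limit along
  the filter \<^const>\<open>ae_filter\<close>.\<close>

definition essinf :: "'a measure \<Rightarrow> ('a \<Rightarrow> ereal) \<Rightarrow> ereal" where
  "essinf \<mu> f = Liminf (ae_filter \<mu>) f"

text \<open>For a real-valued measurable function on a probability space the difference is never
  of the form \<open>\<infinity> - \<infinity>\<close>. Products of extended reals follow the convention \<open>0 * \<infinity> = 0\<close>.\<close>

definition osc :: "'a measure \<Rightarrow> ('a \<Rightarrow> real) \<Rightarrow> ereal" where
  "osc \<mu> f = esssup \<mu> (\<lambda>x. ereal (f x)) - essinf \<mu> (\<lambda>x. ereal (f x))"

section \<open>Markov kernels and weak Poincare inequalities\<close>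

definition markov_kernel :: "'a measure \<Rightarrow> ('a \<Rightarrow> 'a measure) \<Rightarrow> bool" where
  "markov_kernel \<mu> P \<longleftrightarrow> P \<in> \<mu> \<rightarrow>\<^sub>M prob_algebra \<mu>"

definition kernel_op :: "('a \<Rightarrow> 'a measure) \<Rightarrow> ('a \<Rightarrow> real) \<Rightarrow> 'a \<Rightarrow> real" where
  "kernel_op P f x = (\<integral>y. f y \<partial>P x)"

text \<open>The measure \<open>\<mu>(dx) P(x, dy)\<close> on the product space.\<close>

definition joint_law :: "'a measure \<Rightarrow> ('a \<Rightarrow> 'a measure) \<Rightarrow> ('a \<times> 'a) measure" where
  "joint_law \<mu> P = \<mu> \<bind> (\<lambda>x. P x \<bind> (\<lambda>y. return (\<mu> \<Otimes>\<^sub>M \<mu>) (x, y)))"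

definition reversible :: "'a measure \<Rightarrow> ('a \<Rightarrow> 'a measure) \<Rightarrow> bool" where
  "reversible \<mu> P \<longleftrightarrow>
     distr (joint_law \<mu> P) (\<mu> \<Otimes>\<^sub>M \<mu>) (\<lambda>(x, y). (y, x)) = joint_law \<mu> P"

definition positive_kernel :: "'a measure \<Rightarrow> ('a \<Rightarrow> 'a measure) \<Rightarrow> bool" where
  "positive_kernel \<mu> P \<longleftrightarrow> (\<forall>f\<in>L2 \<mu>. 0 \<le> L2_inner \<mu> (kernel_op P f) f)"

definition dirichlet_form :: "'a measure \<Rightarrow> ('a \<Rightarrow> 'a measure) \<Rightarrow> ('a \<Rightarrow> real) \<Rightarrow> real" where
  "dirichlet_form \<mu> P f = L2_inner \<mu> (\<lambda>x. f x - kernel_op P f x) f"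

definition weak_poincare :: "'a measure \<Rightarrow> ('a \<Rightarrow> 'a measure) \<Rightarrow> (real \<Rightarrow> real) \<Rightarrow> bool" where
  "weak_poincare \<mu> P b \<longleftrightarrow>
     prob_space \<mu> \<and> markov_kernel \<mu> P \<and>
     (\<forall>s>0. 0 \<le> b s) \<and> antimono_on {0<..} b \<and> (b \<longlongrightarrow> 0) at_top \<and>
     reversible \<mu> P \<and> positive_kernel \<mu> P \<and>
     (\<forall>s>0. \<forall>f\<in>L2_0 \<mu>.
        ereal ((L2_norm \<mu> f)\<^sup>2) \<le> ereal (s * dirichlet_form \<mu> P f) + ereal (b s) * (osc \<mu> f)\<^sup>2)"

section \<open>Slice sampling and independent Metropolis\<close>

definition normalizer :: "'a measure \<Rightarrow> ('a \<Rightarrow> real) \<Rightarrow> real" where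
  "normalizer \<nu> w = (\<integral>x. w x \<partial>\<nu>)"

definition target :: "'a measure \<Rightarrow> ('a \<Rightarrow> real) \<Rightarrow> 'a measure" where
  "target \<nu> w = density \<nu> (\<lambda>x. ennreal (w x / normalizer \<nu> w))"

definition sup_weight :: "'a measure \<Rightarrow> ('a \<Rightarrow> real) \<Rightarrow> ereal" where
  "sup_weight \<nu> w = (SUP x\<in>space \<nu>. ereal (w x))"

definition levels :: "'a measure \<Rightarrow> ('a \<Rightarrow> real) \<Rightarrow> real set" where
  "levels \<nu> w = {t. 0 < t \<and> ereal t < sup_weight \<nu> w}"

definition level_set :: "'a measure \<Rightarrow> ('a \<Rightarrow> real) \<Rightarrow> real \<Rightarrow> 'a set" where
  "level_set \<nu> w t = {x \<in> space \<nu>. t < w x}"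

definition level_mass :: "'a measure \<Rightarrow> ('a \<Rightarrow> real) \<Rightarrow> real \<Rightarrow> real" where
  "level_mass \<nu> w t = measure \<nu> (level_set \<nu> w t)"

text \<open>The measure \<open>A \<mapsto> \<nu> (A \<inter> level_set \<nu> w t) / \<nu> (level_set \<nu> w t)\<close> on the whole space;
  its restriction to the level set is obtained with \<^const>\<open>restrict_space\<close>.\<close>

definition level_measure :: "'a measure \<Rightarrow> ('a \<Rightarrow> real) \<Rightarrow> real \<Rightarrow> 'a measure" where
  "level_measure \<nu> w t = uniform_measure \<nu> (level_set \<nu> w t)"

definition slice_kernel :: "'a measure \<Rightarrow> ('a \<Rightarrow> real) \<Rightarrow> 'a \<Rightarrow> 'a measure" where
  "slice_kernel \<nu> w x = measure_of (space \<nu>) (sets \<nu>)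
     (\<lambda>A. (\<integral>\<^sup>+t\<in>{0<..<w x}. emeasure (level_measure \<nu> w t) A \<partial>lborel) / ennreal (w x))"

definition accept_prob :: "('a \<Rightarrow> real) \<Rightarrow> 'a \<Rightarrow> 'a \<Rightarrow> real" where
  "accept_prob w x y = min 1 (w y / w x)"

definition metropolis_kernel :: "'a measure \<Rightarrow> ('a \<Rightarrow> real) \<Rightarrow> 'a \<Rightarrow> 'a measure" where
  "metropolis_kernel \<nu> w x = measure_of (space \<nu>) (sets \<nu>)
     (\<lambda>A. (\<integral>\<^sup>+y\<in>A. ennreal (accept_prob w x y) \<partial>\<nu>)
           + indicator A x * (1 - (\<integral>\<^sup>+y. ennreal (accept_prob w x y) \<partial>\<nu>)))"

definition level_kernel :: "'a measure \<Rightarrow> ('a \<Rightarrow> real) \<Rightarrow> real \<Rightarrow> 'a \<Rightarrow> 'a measure" where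
  "level_kernel \<nu> w t x =
     (let G = level_set \<nu> w t in
      measure_of G (sets (restrict_space \<nu> G))
        (\<lambda>A. emeasure \<nu> (A \<inter> G) + indicator A x * (1 - emeasure \<nu> G)))"

text \<open>The set functions passed to \<^const>\<open>measure_of\<close> above are measures, so that the three
  kernels take the prescribed values.\<close>

lemma emeasure_metropolis_kernel:
  assumes "w \<in> borel_measurable \<nu>" "A \<in> sets \<nu>"
  shows "emeasure (metropolis_kernel \<nu> w x) A =
    (\<integral>\<^sup>+y\<in>A. ennreal (accept_prob w x y) \<partial>\<nu>)
      + indicator A x * (1 - (\<integral>\<^sup>+y. ennreal (accept_prob w x y) \<partial>\<nu>))"
proof -
  let ?D = "density \<nu> (\<lambda>y. ennreal (accept_prob w x y))"
  let ?r = "1 - (\<integral>\<^sup>+y. ennreal (accept_prob w x y) \<partial>\<nu>)"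
  have D: "emeasure ?D B = (\<integral>\<^sup>+y\<in>B. ennreal (accept_prob w x y) \<partial>\<nu>)" if "B \<in> sets \<nu>" for B
    using assms(1) that by (subst emeasure_density) (auto simp: accept_prob_def)
  show ?thesis
  proof (rule emeasure_measure_of[OF metropolis_kernel_def])
    show "countably_additive (sets (metropolis_kernel \<nu> w x)) (\<lambda>A. (\<integral>\<^sup>+y\<in>A. ennreal (accept_prob w x y) \<partial>\<nu>) + indicator A x * ?r)"
    proof (rule countably_additiveI)
      fix F :: "nat \<Rightarrow> 'a set"
      assume F: "range F \<subseteq> sets (metropolis_kernel \<nu> w x)" "disjoint_family F"
      then have F': "range F \<subseteq> sets \<nu>" by (simp add: metropolis_kernel_def)
      then have Fi: "F i \<in> sets \<nu>" and U: "(\<Union>i. F i) \<in> sets \<nu>" for i by auto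
      have "(\<Sum>i. emeasure ?D (F i) + indicator (F i) x * ?r) = (\<Sum>i. emeasure ?D (F i)) + (\<Sum>i. indicator (F i) x * ?r)"
        by (rule suminf_add[symmetric]) auto
      also have "(\<Sum>i. emeasure ?D (F i)) = emeasure ?D (\<Union>i. F i)"
        using F' F(2) by (intro suminf_emeasure) auto
      also have "(\<Sum>i. indicator (F i) x * ?r) = indicator (\<Union>i. F i) x * ?r"
        by (simp add: ennreal_suminf_multc suminf_indicator[OF F(2)])
      finally show "(\<Sum>i. (\<integral>\<^sup>+y\<in>F i. ennreal (accept_prob w x y) \<partial>\<nu>) + indicator (F i) x * ?r)
         = (\<integral>\<^sup>+y\<in>(\<Union>i. F i). ennreal (accept_prob w x y) \<partial>\<nu>) + indicator (\<Union>i. F i) x * ?r"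
        by (simp only: D[OF Fi] D[OF U])
    qed
  qed (use assms sets.space_closed in \<open>auto simp: positive_def metropolis_kernel_def\<close>)
qed

lemma emeasure_slice_kernel:
  assumes "prob_space \<nu>" "w \<in> borel_measurable \<nu>" "A \<in> sets \<nu>"
  shows "emeasure (slice_kernel \<nu> w x) A =
    (\<integral>\<^sup>+t\<in>{0<..<w x}. emeasure (level_measure \<nu> w t) A \<partial>lborel) / ennreal (w x)"
proof -
  interpret prob_space \<nu> by fact
  have mono: "(\<lambda>t. emeasure \<nu> (level_set \<nu> w t \<inter> B)) \<in> borel_measurable borel" if "B \<in> sets \<nu>" for B
  proof -
    have "(\<lambda>t. measure \<nu> (level_set \<nu> w (- t) \<inter> B)) \<in> borel_measurable borel"
      using assms(2) that
      by (intro borel_measurable_mono monoI finite_measure_mono) (auto simp: level_set_def)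
    then have "(\<lambda>t. measure \<nu> (level_set \<nu> w (- (- t)) \<inter> B)) \<in> borel_measurable borel"
      by measurable
    then show ?thesis by (simp add: emeasure_eq_measure)
  qed
  have L: "emeasure (level_measure \<nu> w t) B = emeasure \<nu> (level_set \<nu> w t \<inter> B) / emeasure \<nu> (level_set \<nu> w t \<inter> space \<nu>)" if "B \<in> sets \<nu>" for B t
    using assms(2) that by (simp add: level_measure_def level_set_def Int_absorb2)
  have meas[measurable]: "(\<lambda>t. emeasure (level_measure \<nu> w t) B) \<in> borel_measurable borel" if "B \<in> sets \<nu>" for B
    unfolding L[OF that] using mono[OF that] mono[OF sets.top] by measurable
  show ?thesis
  proof (rule emeasure_measure_of[OF slice_kernel_def])
    show "countably_additive (sets (slice_kernel \<nu> w x)) (\<lambda>A. (\<integral>\<^sup>+t\<in>{0<..<w x}. emeasure (level_measure \<nu> w t) A \<partial>lborel) / ennreal (w x))"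
    proof (rule countably_additiveI)
      fix F :: "nat \<Rightarrow> 'a set"
      assume F: "range F \<subseteq> sets (slice_kernel \<nu> w x)" "disjoint_family F"
      then have F': "range F \<subseteq> sets \<nu>" by (simp add: slice_kernel_def)
      then have Fi: "F i \<in> sets \<nu>" for i by auto
      have "emeasure (level_measure \<nu> w t) (\<Union>i. F i) = (\<Sum>i. emeasure (level_measure \<nu> w t) (F i))" for t
        using F' F(2) by (intro suminf_emeasure[symmetric]) (auto simp: level_measure_def)
      then show "(\<Sum>i. (\<integral>\<^sup>+t\<in>{0<..<w x}. emeasure (level_measure \<nu> w t) (F i) \<partial>lborel) / ennreal (w x))
        = (\<integral>\<^sup>+t\<in>{0<..<w x}. emeasure (level_measure \<nu> w t) (\<Union>i. F i) \<partial>lborel) / ennreal (w x)"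
        using Fi by (simp add: divide_ennreal_def ennreal_suminf_multc nn_integral_suminf[symmetric])
    qed
  qed (use assms sets.space_closed in \<open>auto simp: positive_def slice_kernel_def\<close>)
qed

lemma emeasure_level_kernel:
  assumes "w \<in> borel_measurable \<nu>"
    and "A \<in> sets (restrict_space \<nu> (level_set \<nu> w t))"
  shows "emeasure (level_kernel \<nu> w t x) A =
    emeasure \<nu> (A \<inter> level_set \<nu> w t) + indicator A x * (1 - emeasure \<nu> (level_set \<nu> w t))"
proof -
  let ?G = "level_set \<nu> w t"
  let ?r = "1 - emeasure \<nu> ?G"
  have G: "?G \<in> sets \<nu>" using assms(1) by (simp add: level_set_def)
  have K: "level_kernel \<nu> w t x = measure_of ?G (sets (restrict_space \<nu> ?G)) (\<lambda>A. emeasure \<nu> (A \<inter> ?G) + indicator A x * ?r)"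
    by (simp add: level_kernel_def Let_def)
  have sub: "sets (restrict_space \<nu> ?G) \<subseteq> Pow ?G" by (auto simp: sets_restrict_space)
  have S: "sets (level_kernel \<nu> w t x) = sets (restrict_space \<nu> ?G)"
    unfolding K sets_measure_of[OF sub] 
    using sets.sigma_sets_eq[of "restrict_space \<nu> ?G"] G sets.sets_into_space[OF G]
    by (simp add: space_restrict_space Int_absorb2)
  show ?thesis
  proof (rule emeasure_measure_of[OF K sub])
    show "countably_additive (sets (level_kernel \<nu> w t x)) (\<lambda>A. emeasure \<nu> (A \<inter> ?G) + indicator A x * ?r)"
    proof (rule countably_additiveI)
      fix F :: "nat \<Rightarrow> 'a set"
      assume F: "range F \<subseteq> sets (level_kernel \<nu> w t x)" "disjoint_family F"
      have "F i \<in> sets \<nu>" for i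
        using F(1) G unfolding S by (subst (asm) image_subset_iff) (simp add: sets_restrict_space_iff)
      then have F': "range (\<lambda>i. F i \<inter> ?G) \<subseteq> sets \<nu>" "disjoint_family (\<lambda>i. F i \<inter> ?G)"
        using G F(2) by (auto simp: disjoint_family_on_def)
      have "(\<Sum>i. emeasure \<nu> (F i \<inter> ?G) + indicator (F i) x * ?r) = (\<Sum>i. emeasure \<nu> (F i \<inter> ?G)) + (\<Sum>i. indicator (F i) x * ?r)"
        by (rule suminf_add[symmetric]) auto
      also have "(\<Sum>i. emeasure \<nu> (F i \<inter> ?G)) = emeasure \<nu> ((\<Union>i. F i) \<inter> ?G)"
        using suminf_emeasure[OF F'] by simp
      also have "(\<Sum>i. indicator (F i) x * ?r) = indicator (\<Union>i. F i) x * ?r"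
        by (simp add: ennreal_suminf_multc suminf_indicator[OF F(2)])
      finally show "(\<Sum>i. emeasure \<nu> (F i \<inter> ?G) + indicator (F i) x * ?r) = emeasure \<nu> ((\<Union>i. F i) \<inter> ?G) + indicator (\<Union>i. F i) x * ?r" .
    qed
  qed (use assms S in \<open>auto simp: positive_def\<close>)
qed
end

theory Submission
  imports Defs
begin

text \<open>The Dirichlet forms of both kernels are mixtures over the levels \<open>t\<close>. With
  \<open>D t = \<integral>\<integral> (f x - f y)\<^sup>2 \<nu>(dx) \<nu>(dy)\<close> over the square of the level set, the layer-cake formula
  \<open>min (w x) (w y) = \<integral> 1(t < w x) 1(t < w y) dt\<close> gives
  \<open>2 c E(M, f) = \<integral> D t dt\<close> and \<open>2 c E(U, f) = \<integral> D t / m t dt\<close>.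
  The first inequality is \<open>m t \<le> 1\<close>. For the second, \<open>D t / m t \<le> s D t\<close> if \<open>s \<ge> 1 / m t\<close>, and
  otherwise \<open>D t / (m t)\<^sup>2\<close> is twice the variance of \<open>f\<close> on the level set, hence at most half the
  squared oscillation by Popoviciu's inequality. Working with nonnegative integrals
  avoids all integrability conditions until the end.\<close>

text \<open>With respect to the target, Metropolis has the symmetric density
  \<open>c * min (w x) (w y) / (w x * w y)\<close>. Multiplied by the two factors
  \<open>w x / c\<close> and \<open>w y / c\<close> of the product measure, it leaves the minimum
  over \<open>c\<close>. This is where \<open>c\<close> in the two formulas comes from; the 2 comes
  from symmetrising the Dirichlet form. Both energies are then superpositions of the same
  \<open>D t\<close>, weighted by 1 or by \<open>1 / m t\<close>, so everything can be compared
  level by level. Since \<open>D t\<close> is \<open>2 * m t\<close> times the Dirichlet form of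
  \<open>H_t\<close>, the estimate on one level is the weak Poincare inequality of
  \<open>H_t\<close> multiplied by \<open>2 * m t\<close>. Its remainder \<open>m t\<close> times
  half the squared oscillation, divided by \<open>2 * c\<close>, yields the constant
  \<open>1 / (4 * c)\<close>. Two degenerate situations need care. A null level set would make
  \<open>1 / m t\<close> infinite: below the supremum this is excluded by its equality with the
  essential supremum, above it \<open>D t\<close> vanishes. An infinite oscillation makes the bound
  trivial unless the remainder integral is zero, and then \<open>0 * \<infinity> = 0\<close> removes
  the term.\<close>

section \<open>Oscillation, variance and Popoviciu's inequality\<close>

lemma osc_square_cases:
  assumes f: "f \<in> borel_measurable \<mu>"
  obtains "(osc \<mu> f)\<^sup>2 = \<infinity>"
  | a b where "AE x in \<mu>. f x \<in> {a..b}" "(osc \<mu> f)\<^sup>2 = ereal ((b - a)\<^sup>2)"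
proof -
  have m: "(\<lambda>x. - ereal (f x)) \<in> borel_measurable \<mu>"
    using f by measurable
  have essinf: "essinf \<mu> (\<lambda>x. ereal (f x)) = - esssup \<mu> (\<lambda>x. - ereal (f x))"
    using m by (simp add: essinf_def esssup_def ereal_Limsup_uminus del: uminus_ereal.simps)
  have lower: "AE x in \<mu>. essinf \<mu> (\<lambda>x. ereal (f x)) \<le> ereal (f x)"
    using esssup_AE[of "\<lambda>x. - ereal (f x)" \<mu>] unfolding essinf
    by eventually_elim (metis ereal_minus_le_minus ereal_uminus_uminus)
  have upper: "AE x in \<mu>. ereal (f x) \<le> esssup \<mu> (\<lambda>x. ereal (f x))"
    by (rule esssup_AE)
  show ?thesis
  proof (cases "esssup \<mu> (\<lambda>x. ereal (f x))"; cases "essinf \<mu> (\<lambda>x. ereal (f x))")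
    fix a b assume *: "esssup \<mu> (\<lambda>x. ereal (f x)) = ereal b" "essinf \<mu> (\<lambda>x. ereal (f x)) = ereal a"
    show ?thesis
    proof (rule that(2))
      show "AE x in \<mu>. f x \<in> {a..b}"
        using lower upper unfolding * by eventually_elim auto
      show "(osc \<mu> f)\<^sup>2 = ereal ((b - a)\<^sup>2)"
        by (simp add: osc_def *)
    qed
  \<comment> \<open>The eight cases with an infinite extreme: the extended difference is infinite of
    either sign (with \<open>\<infinity> - \<infinity> = \<infinity>\<close>), so its square is
    infinite.\<close>
  qed (use that(1) in \<open>auto simp: osc_def power2_eq_square\<close>)
qed

text \<open>Expanding the square gives the second moment twice and the cross term
  \<open>-2 * (expectation f)^2\<close>. The inner integral is evaluated as a Bochner integral,
  where subtraction is available; its value \<open>?g x\<close> is nonnegative as the integral of a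
  square.\<close>

lemma (in prob_space) nn_integral_square_diff:
  fixes f :: "'a \<Rightarrow> real"
  assumes f: "f \<in> L2 M"
  shows "(\<integral>\<^sup>+x. \<integral>\<^sup>+y. ennreal ((f x - f y)\<^sup>2) \<partial>M \<partial>M) = ennreal (2 * variance f)"
proof -
  have [measurable]: "f \<in> borel_measurable M" and f2: "integrable M (\<lambda>x. (f x)\<^sup>2)"
    using f by (auto simp: L2_def)
  have f1: "integrable M f"
    using f2 by (rule square_integrable_imp_integrable[rotated]) simp
  let ?g = "\<lambda>x. (f x)\<^sup>2 - 2 * f x * expectation f + expectation (\<lambda>y. (f y)\<^sup>2)"
  have inner: "has_bochner_integral M (\<lambda>y. (f x - f y)\<^sup>2) (?g x)" for x
  proof -
    have "has_bochner_integral M (\<lambda>y. (f x)\<^sup>2 - 2 * f x * f y + (f y)\<^sup>2) (?g x)"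
      using f1 f2 by (simp add: has_bochner_integral_iff prob_space)
    then show ?thesis by (simp add: power2_diff algebra_simps)
  qed
  have int_g: "integrable M ?g"
    using f1 f2 by simp
  have "(\<integral>\<^sup>+x. \<integral>\<^sup>+y. ennreal ((f x - f y)\<^sup>2) \<partial>M \<partial>M) = (\<integral>\<^sup>+x. ennreal (?g x) \<partial>M)"
    using inner by (intro nn_integral_cong)
      (subst nn_integral_eq_integral, auto simp: has_bochner_integral_iff)
  also have "\<dots> = ennreal (expectation ?g)"
  proof (rule nn_integral_eq_integral[OF int_g])
    show "AE x in M. 0 \<le> ?g x"
      using inner
      by (intro AE_I2) (metis has_bochner_integral_integral_eq Bochner_Integration.integral_nonneg zero_le_power2)
  qed
  also have "expectation ?g = 2 * variance f"
    unfolding variance_eq[OF f1 f2] using f1 f2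
    by (simp add: prob_space power2_eq_square algebra_simps)
  finally show ?thesis .
qed

text \<open>The mean minimises the mean square deviation, so the variance is at most the deviation
  from the midpoint of \<open>{a..b}\<close>, from which no point of the interval is farther than
  \<open>(b - a) / 2\<close>.\<close>

lemma (in prob_space) nn_integral_square_diff_le_osc:
  fixes f :: "'a \<Rightarrow> real"
  assumes [measurable]: "f \<in> borel_measurable M" and ab: "AE x in M. f x \<in> {a..b}"
  shows "(\<integral>\<^sup>+x. \<integral>\<^sup>+y. ennreal ((f x - f y)\<^sup>2) \<partial>M \<partial>M) \<le> ennreal ((b - a)\<^sup>2 / 2)"
proof -
  let ?c = "(a + b) / 2"
  have close: "AE x in M. (f x - ?c)\<^sup>2 \<le> ((b - a) / 2)\<^sup>2"
    using ab by eventually_elim (auto intro!: abs_le_square_iff[THEN iffD1] simp: abs_le_iff field_simps)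
  have f1: "integrable M f"
    using ab by (intro integrable_const_bound[of _ "max \<bar>a\<bar> \<bar>b\<bar>"]) auto
  have d2: "integrable M (\<lambda>x. (f x - ?c)\<^sup>2)"
    using close by (intro integrable_const_bound[of _ "((b - a) / 2)\<^sup>2"]) auto
  \<comment> \<open>This sum is \<open>(f x)^2\<close>, so square integrability of \<open>f\<close>
    follows from that of the centred function.\<close>
  have "integrable M (\<lambda>x. (f x - ?c)\<^sup>2 + 2 * ?c * f x - ?c\<^sup>2)"
    using f1 d2 by (intro Bochner_Integration.integrable_diff Bochner_Integration.integrable_add) auto
  then have f2: "integrable M (\<lambda>x. (f x)\<^sup>2)"
    by (simp add: power2_diff algebra_simps)
  have "variance f = expectation (\<lambda>x. (f x - ?c)\<^sup>2) - (expectation f - ?c)\<^sup>2"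
  proof -
    have "expectation (\<lambda>x. (f x - ?c)\<^sup>2) = expectation (\<lambda>x. (f x)\<^sup>2 - 2 * ?c * f x + ?c\<^sup>2)"
      by (simp add: power2_diff algebra_simps)
    also have "\<dots> = expectation (\<lambda>x. (f x)\<^sup>2) - 2 * ?c * expectation f + ?c\<^sup>2"
      using f1 f2 by (simp add: prob_space)
    finally show ?thesis
      unfolding variance_eq[OF f1 f2] by (simp add: power2_eq_square field_simps)
  qed
  also have "\<dots> \<le> expectation (\<lambda>x. ((b - a) / 2)\<^sup>2)"
    using close d2 by (intro order_trans[OF _ integral_mono_AE[OF d2 _ close]]) auto
  finally have "2 * variance f \<le> (b - a)\<^sup>2 / 2"
    by (simp add: prob_space power_divide)
  then show ?thesis
    using f2 by (subst nn_integral_square_diff) (auto simp: L2_def intro: ennreal_leI)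
qed

section \<open>Dirichlet forms of invariant and of reversible kernels\<close>

text \<open>Invariance applied to \<open>(f y)^2\<close> shows that \<open>f\<close> is square
  integrable under \<open>P x\<close> for almost every \<open>x\<close>. Hence
  \<open>kernel_op P f\<close> is a genuine integral almost everywhere, and the expanded square can
  be integrated term by term.\<close>

lemma dirichlet_form_invariant:
  assumes "prob_space \<mu>" and P: "markov_kernel \<mu> P" and f: "f \<in> L2 \<mu>"
    and inv: "\<And>h. h \<in> borel_measurable \<mu> \<Longrightarrow> (\<integral>\<^sup>+x. \<integral>\<^sup>+y. h y \<partial>P x \<partial>\<mu>) = (\<integral>\<^sup>+x. h x \<partial>\<mu>)"
  shows "dirichlet_form \<mu> P f = (L2_norm \<mu> f)\<^sup>2 - L2_inner \<mu> (kernel_op P f) f"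
    and "0 \<le> dirichlet_form \<mu> P f"
    and "ennreal (2 * dirichlet_form \<mu> P f) = (\<integral>\<^sup>+x. \<integral>\<^sup>+y. ennreal ((f x - f y)\<^sup>2) \<partial>P x \<partial>\<mu>)"
proof -
  interpret prob_space \<mu> by fact
  have [measurable]: "f \<in> borel_measurable \<mu>" and f2: "integrable \<mu> (\<lambda>x. (f x)\<^sup>2)"
    using f by (auto simp: L2_def)
  have Pp: "P \<in> \<mu> \<rightarrow>\<^sub>M prob_algebra \<mu>"
    using P by (simp add: markov_kernel_def)
  then have Ps [measurable]: "P \<in> \<mu> \<rightarrow>\<^sub>M subprob_algebra \<mu>"
    by (rule measurable_prob_algebraD)
  have prob: "prob_space (P x)" and sets_P: "sets (P x) = sets \<mu>" if "x \<in> space \<mu>" for x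
    using measurable_space[OF Pp that] by (auto simp: space_prob_algebra)
  let ?A = "kernel_op P f" and ?B = "\<lambda>x. \<integral>y. (f y)\<^sup>2 \<partial>P x"
  let ?N = "\<lambda>x. \<integral>\<^sup>+y. ennreal ((f y)\<^sup>2) \<partial>P x"
  have [measurable]: "?A \<in> borel_measurable \<mu>" "?B \<in> borel_measurable \<mu>" "?N \<in> borel_measurable \<mu>"
    unfolding kernel_op_def by measurable
  have N: "(\<integral>\<^sup>+x. ?N x \<partial>\<mu>) = ennreal (\<integral>x. (f x)\<^sup>2 \<partial>\<mu>)"
    using f2 by (subst inv) (auto intro: nn_integral_eq_integral)
  have "AE x in \<mu>. ?N x \<noteq> \<infinity>"
    by (rule nn_integral_PInf_AE) (simp_all add: N)
  \<comment> \<open>Used for \<open>s = 1\<close> (Dirichlet form) and \<open>s = -1\<close> (to bound \<open>\<bar>f * P f\<bar>\<close> from both sides).\<close>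
  with AE_space have good: "AE x in \<mu>. has_bochner_integral (P x) (\<lambda>y. (f x - s * f y)\<^sup>2)
       ((f x)\<^sup>2 - 2 * s * (f x * ?A x) + s\<^sup>2 * ?B x) \<and> ?N x = ennreal (?B x)" for s
  proof eventually_elim
    case (elim x)
    then have x: "x \<in> space \<mu>" and xt: "?N x \<noteq> \<infinity>" by auto
    interpret Px: prob_space "P x" using prob[OF x] .
    have [measurable]: "f \<in> borel_measurable (P x)"
      using sets_P[OF x] by (simp cong: measurable_cong_sets)
    have i2: "integrable (P x) (\<lambda>y. (f y)\<^sup>2)"
      using xt by (intro integrableI_bounded) (auto simp: less_top)
    have i1: "integrable (P x) f"
      using i2 by (rule Px.square_integrable_imp_integrable[rotated]) simp
    have "has_bochner_integral (P x) (\<lambda>y. (f x)\<^sup>2 - 2 * s * f x * f y + s\<^sup>2 * (f y)\<^sup>2)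
        ((f x)\<^sup>2 - 2 * s * (f x * ?A x) + s\<^sup>2 * ?B x)"
      using i1 i2 by (simp add: has_bochner_integral_iff Px.prob_space kernel_op_def)
    moreover have "?N x = ennreal (?B x)"
      using i2 by (intro nn_integral_eq_integral) auto
    ultimately show ?case
      by (simp add: power2_diff power_mult_distrib algebra_simps)
  qed
  have B: "has_bochner_integral \<mu> ?B (\<integral>x. (f x)\<^sup>2 \<partial>\<mu>)"
  proof (rule has_bochner_integral_nn_integral)
    show "(\<integral>\<^sup>+x. ennreal (?B x) \<partial>\<mu>) = ennreal (\<integral>x. (f x)\<^sup>2 \<partial>\<mu>)"
      unfolding N[symmetric] using good[of 1] by (intro nn_integral_cong_AE) auto
  qed (auto simp: integral_nonneg)
  have nonneg: "AE x in \<mu>. 0 \<le> (f x)\<^sup>2 - 2 * s * (f x * ?A x) + s\<^sup>2 * ?B x" for s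
    using good[of s] 
    by eventually_elim
      (metis has_bochner_integral_integral_eq Bochner_Integration.integral_nonneg zero_le_power2)
  have fA: "integrable \<mu> (\<lambda>x. ?A x * f x)"
  proof (rule Bochner_Integration.integrable_bound)
    show "integrable \<mu> (\<lambda>x. (f x)\<^sup>2 + ?B x)"
      using f2 B by (auto simp: has_bochner_integral_iff)
    show "AE x in \<mu>. norm (?A x * f x) \<le> norm ((f x)\<^sup>2 + ?B x)"
      using nonneg[of 1] nonneg[of "- 1"] by eventually_elim (auto simp: abs_if mult.commute)
  qed measurable
  show *: "dirichlet_form \<mu> P f = (L2_norm \<mu> f)\<^sup>2 - L2_inner \<mu> ?A f"
    using f2 fA by (simp add: dirichlet_form_def L2_norm_def L2_inner_def left_diff_distrib
        power2_eq_square[symmetric])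
  \<comment> \<open>By invariance the first and the last term have the same integral, the squared
    norm; this doubles the form.\<close>
  have "has_bochner_integral \<mu> (\<lambda>x. (f x)\<^sup>2 - 2 * (?A x * f x) + ?B x) (2 * dirichlet_form \<mu> P f)"
    unfolding * using f2 fA B
    by (simp add: has_bochner_integral_iff L2_norm_def L2_inner_def power2_eq_square[symmetric])
  then have D: "has_bochner_integral \<mu> (\<lambda>x. (f x)\<^sup>2 - 2 * 1 * (f x * ?A x) + 1\<^sup>2 * ?B x)
      (2 * dirichlet_form \<mu> P f)"
    by (simp add: mult.commute)
  show "0 \<le> dirichlet_form \<mu> P f"
    using integral_nonneg_AE[OF nonneg[of 1]] D by (simp add: has_bochner_integral_iff)
  have "(\<integral>\<^sup>+x. \<integral>\<^sup>+y. ennreal ((f x - f y)\<^sup>2) \<partial>P x \<partial>\<mu>) =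
      (\<integral>\<^sup>+x. ennreal ((f x)\<^sup>2 - 2 * 1 * (f x * ?A x) + 1\<^sup>2 * ?B x) \<partial>\<mu>)"
  proof (rule nn_integral_cong_AE)
    show "AE x in \<mu>. (\<integral>\<^sup>+y. ennreal ((f x - f y)\<^sup>2) \<partial>P x) =
        ennreal ((f x)\<^sup>2 - 2 * 1 * (f x * ?A x) + 1\<^sup>2 * ?B x)"
      using good[of 1]
    proof eventually_elim
      case (elim x)
      then have "integrable (P x) (\<lambda>y. (f x - f y)\<^sup>2)"
        "(\<integral>y. (f x - f y)\<^sup>2 \<partial>P x) = (f x)\<^sup>2 - 2 * 1 * (f x * ?A x) + 1\<^sup>2 * ?B x"
        by (auto simp: has_bochner_integral_iff)
      then show ?case by (subst nn_integral_eq_integral) auto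
    qed
  qed
  also have "\<dots> = ennreal (2 * dirichlet_form \<mu> P f)"
    using D nonneg[of 1] by (subst nn_integral_eq_integral) (auto simp: has_bochner_integral_iff)
  finally show "ennreal (2 * dirichlet_form \<mu> P f) =
      (\<integral>\<^sup>+x. \<integral>\<^sup>+y. ennreal ((f x - f y)\<^sup>2) \<partial>P x \<partial>\<mu>)" ..
qed

text \<open>The kernels \<open>P(x, dy) = k x y \<mu>(dy) + (1 - \<integral> k x) \<delta>\<^sub>x(dy)\<close> with a symmetric density \<open>k\<close>
  cover all three kernels of interest: \<^const>\<open>level_kernel\<close> with constant \<open>k\<close>, and
  \<^const>\<open>metropolis_kernel\<close> and \<^const>\<open>slice_kernel\<close> with \<open>\<mu>\<close> the target.\<close>

locale symmetric_kernel = prob_space \<mu> for \<mu> :: "'a measure" +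
  fixes k :: "'a \<Rightarrow> 'a \<Rightarrow> ennreal" and P :: "'a \<Rightarrow> 'a measure"
  assumes k_measurable [measurable]: "(\<lambda>(x, y). k x y) \<in> borel_measurable (\<mu> \<Otimes>\<^sub>M \<mu>)"
    and k_sym: "k x y = k y x"
    and k_mass: "x \<in> space \<mu> \<Longrightarrow> (\<integral>\<^sup>+y. k x y \<partial>\<mu>) \<le> 1"
    and sets_P: "x \<in> space \<mu> \<Longrightarrow> sets (P x) = sets \<mu>"
    and emeasure_P: "x \<in> space \<mu> \<Longrightarrow> A \<in> sets \<mu> \<Longrightarrow> emeasure (P x) A =
      (\<integral>\<^sup>+y\<in>A. k x y \<partial>\<mu>) + indicator A x * (1 - (\<integral>\<^sup>+y. k x y \<partial>\<mu>))"
begin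

sublocale pair: pair_prob_space \<mu> \<mu> ..

lemma k_measurable2 [measurable]: "x \<in> space \<mu> \<Longrightarrow> k x \<in> borel_measurable \<mu>"
  using measurable_compose[OF measurable_Pair1' k_measurable] by simp

lemma k_mass_complement:
  assumes "x \<in> space \<mu>"
  shows "(\<integral>\<^sup>+y. k x y \<partial>\<mu>) + (1 - (\<integral>\<^sup>+y. k x y \<partial>\<mu>)) = 1"
  using k_mass[OF assms] by (simp add: add_diff_inverse_ennreal)

lemma markov_kernel: "markov_kernel \<mu> P"
  unfolding markov_kernel_def
proof (intro measurable_prob_algebraI measurable_subprob_algebra)
  show prob: "prob_space (P x)" if "x \<in> space \<mu>" for x
  proof (rule prob_spaceI)
    have "emeasure (P x) (space \<mu>) = (\<integral>\<^sup>+y. k x y \<partial>\<mu>) + (1 - (\<integral>\<^sup>+y. k x y \<partial>\<mu>))"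
      using that by (simp add: emeasure_P indicator_def cong: nn_integral_cong)
    then show "emeasure (P x) (space (P x)) = 1"
      using that by (simp add: sets_eq_imp_space_eq[OF sets_P] k_mass_complement)
  qed
  show "subprob_space (P x)" if "x \<in> space \<mu>" for x
    using prob[OF that] by (rule prob_space_imp_subprob_space)
  fix A assume [measurable]: "A \<in> sets \<mu>"
  have "(\<lambda>x. (\<integral>\<^sup>+y\<in>A. k x y \<partial>\<mu>) + indicator A x * (1 - (\<integral>\<^sup>+y. k x y \<partial>\<mu>))) \<in> borel_measurable \<mu>"
    by measurable
  then show "(\<lambda>x. emeasure (P x) A) \<in> borel_measurable \<mu>"
    by (subst measurable_cong[OF emeasure_P]) auto
qed (use sets_P in auto)

lemma P_subprob [measurable]: "P \<in> \<mu> \<rightarrow>\<^sub>M subprob_algebra \<mu>"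
  using markov_kernel unfolding markov_kernel_def by (rule measurable_prob_algebraD)

text \<open>\<open>P x\<close> is known only through its values on sets, so the formula is lifted by
  induction on measurable functions. In the limit step the supremum splits over the sum because both
  summands increase.\<close>

lemma nn_integral_P:
  assumes "h \<in> borel_measurable \<mu>" and x: "x \<in> space \<mu>"
  shows "(\<integral>\<^sup>+y. h y \<partial>P x) = (\<integral>\<^sup>+y. h y * k x y \<partial>\<mu>) + h x * (1 - (\<integral>\<^sup>+y. k x y \<partial>\<mu>))"
  using assms(1)
proof induction
  case (cong f g)
  then have "(\<integral>\<^sup>+y. f y \<partial>P x) = (\<integral>\<^sup>+y. g y \<partial>P x)"
    by (intro nn_integral_cong) (simp add: sets_eq_imp_space_eq[OF sets_P[OF x]])
  moreover have "(\<integral>\<^sup>+y. f y * k x y \<partial>\<mu>) = (\<integral>\<^sup>+y. g y * k x y \<partial>\<mu>)"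
    using cong by (intro nn_integral_cong) auto
  ultimately show ?case using cong x by simp
next
  case (set A)
  then show ?case
    using x sets_P[OF x] by (simp add: emeasure_P mult.commute)
next
  case (mult u c)
  have [measurable]: "u \<in> borel_measurable (P x)" "u \<in> borel_measurable \<mu>"
    using mult sets_P[OF x] by (simp_all cong: measurable_cong_sets)
  show ?case
    using mult x by (simp add: nn_integral_cmult mult.assoc distrib_left)
next
  case (add u v)
  have [measurable]: "u \<in> borel_measurable (P x)" "u \<in> borel_measurable \<mu>"
      "v \<in> borel_measurable (P x)" "v \<in> borel_measurable \<mu>"
    using add sets_P[OF x] by (simp_all cong: measurable_cong_sets)
  have "(\<integral>\<^sup>+y. (u y + v y) * k x y \<partial>\<mu>) = (\<integral>\<^sup>+y. u y * k x y \<partial>\<mu>) + (\<integral>\<^sup>+y. v y * k x y \<partial>\<mu>)"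
    unfolding distrib_right using x by (intro nn_integral_add) measurable
  moreover have "(\<integral>\<^sup>+y. u y + v y \<partial>P x) = (\<integral>\<^sup>+y. u y \<partial>P x) + (\<integral>\<^sup>+y. v y \<partial>P x)"
    by (rule nn_integral_add) measurable
  ultimately show ?case
    using add by (simp add: distrib_right ac_simps)
next
  case (seq U)
  let ?r = "1 - (\<integral>\<^sup>+y. k x y \<partial>\<mu>)"
  have [measurable]: "U i \<in> borel_measurable (P x)" "U i \<in> borel_measurable \<mu>" for i
    using seq sets_P[OF x] by (simp_all cong: measurable_cong_sets)
  have inc: "incseq (\<lambda>i. \<integral>\<^sup>+y. U i y * k x y \<partial>\<mu>)" "incseq (\<lambda>i. U i x * ?r)"
    using \<open>incseq U\<close> by (auto simp: incseq_def le_fun_def intro!: nn_integral_mono mult_right_mono)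
  have "(\<integral>\<^sup>+y. (SUP i. U i) y \<partial>P x) = (SUP i. \<integral>\<^sup>+y. U i y \<partial>P x)"
    using \<open>incseq U\<close> by (simp add: nn_integral_monotone_convergence_SUP image_comp)
  also have "\<dots> = (SUP i. (\<integral>\<^sup>+y. U i y * k x y \<partial>\<mu>) + U i x * ?r)"
    using seq by simp
  also have "\<dots> = (SUP i. \<integral>\<^sup>+y. U i y * k x y \<partial>\<mu>) + (SUP i. U i x * ?r)"
    using inc by (rule ennreal_SUP_add)
  also have "(SUP i. \<integral>\<^sup>+y. U i y * k x y \<partial>\<mu>) = (\<integral>\<^sup>+y. (SUP i. U i y * k x y) \<partial>\<mu>)"
    using \<open>incseq U\<close> x
    by (intro nn_integral_monotone_convergence_SUP[symmetric])
       (auto simp: incseq_def le_fun_def intro!: mult_right_mono)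
  finally show ?case
    by (simp add: SUP_mult_right_ennreal image_comp)
qed

text \<open>The density part is symmetric by Fubini and \<open>k_sym\<close>; the holding part lives
  on the diagonal, where exchanging the arguments changes nothing.\<close>

lemma nn_integral_P_swap:
  assumes [measurable]: "(\<lambda>(x, y). g x y) \<in> borel_measurable (\<mu> \<Otimes>\<^sub>M \<mu>)"
  shows "(\<integral>\<^sup>+x. \<integral>\<^sup>+y. g y x \<partial>P x \<partial>\<mu>) = (\<integral>\<^sup>+x. \<integral>\<^sup>+y. g x y \<partial>P x \<partial>\<mu>)"
proof -
  have m: "g x \<in> borel_measurable \<mu>" "(\<lambda>y. g y x) \<in> borel_measurable \<mu>" if [measurable]: "x \<in> space \<mu>" for x
    by measurable
  let ?r = "\<lambda>x. 1 - (\<integral>\<^sup>+y. k x y \<partial>\<mu>)"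
  have "(\<integral>\<^sup>+x. \<integral>\<^sup>+y. g y x \<partial>P x \<partial>\<mu>) = (\<integral>\<^sup>+x. (\<integral>\<^sup>+y. g y x * k x y \<partial>\<mu>) + g x x * ?r x \<partial>\<mu>)"
    using m by (intro nn_integral_cong nn_integral_P) auto
  also have "\<dots> = (\<integral>\<^sup>+x. \<integral>\<^sup>+y. g y x * k x y \<partial>\<mu> \<partial>\<mu>) + (\<integral>\<^sup>+x. g x x * ?r x \<partial>\<mu>)"
    by (rule nn_integral_add) measurable
  also have "(\<integral>\<^sup>+x. \<integral>\<^sup>+y. g y x * k x y \<partial>\<mu> \<partial>\<mu>) = (\<integral>\<^sup>+x. \<integral>\<^sup>+y. g x y * k x y \<partial>\<mu> \<partial>\<mu>)"
    by (subst pair.Fubini') (auto simp: k_sym)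
  also have "(\<integral>\<^sup>+x. \<integral>\<^sup>+y. g x y * k x y \<partial>\<mu> \<partial>\<mu>) + (\<integral>\<^sup>+x. g x x * ?r x \<partial>\<mu>)
      = (\<integral>\<^sup>+x. (\<integral>\<^sup>+y. g x y * k x y \<partial>\<mu>) + g x x * ?r x \<partial>\<mu>)"
    by (rule nn_integral_add[symmetric]) measurable
  also have "\<dots> = (\<integral>\<^sup>+x. \<integral>\<^sup>+y. g x y \<partial>P x \<partial>\<mu>)"
    using m by (intro nn_integral_cong nn_integral_P[symmetric]) auto
  finally show ?thesis .
qed

text \<open>Reversibility tested on a function of one coordinate: after the swap the integrand is
  constant in \<open>y\<close>, and \<open>P x\<close> has total mass 1.\<close>

lemma invariant:
  assumes [measurable]: "h \<in> borel_measurable \<mu>"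
  shows "(\<integral>\<^sup>+x. \<integral>\<^sup>+y. h y \<partial>P x \<partial>\<mu>) = (\<integral>\<^sup>+x. h x \<partial>\<mu>)"
proof -
  have "(\<integral>\<^sup>+x. \<integral>\<^sup>+y. h y \<partial>P x \<partial>\<mu>) = (\<integral>\<^sup>+x. \<integral>\<^sup>+y. h x \<partial>P x \<partial>\<mu>)"
    by (rule nn_integral_P_swap[of "\<lambda>x y. h x"]) measurable
  also have "\<dots> = (\<integral>\<^sup>+x. h x \<partial>\<mu>)"
    using markov_kernel
    by (intro nn_integral_cong)
       (auto simp: markov_kernel_def space_prob_algebra prob_space.emeasure_space_1 dest!: measurable_space)
  finally show ?thesis .
qed

text \<open>Evaluated on a set \<open>B\<close>, both joint laws are iterated integrals of its
  indicator, and \<open>nn_integral_P_swap\<close> exchanges the coordinates.\<close>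

lemma reversible: "reversible \<mu> P"
  unfolding reversible_def
proof (rule measure_eqI)
  have joint: "emeasure (joint_law \<mu> P) B = (\<integral>\<^sup>+x. \<integral>\<^sup>+y. indicator B (x, y) \<partial>P x \<partial>\<mu>)"
    if [measurable]: "B \<in> sets (\<mu> \<Otimes>\<^sub>M \<mu>)" for B
  proof -
    have "emeasure (joint_law \<mu> P) B =
        (\<integral>\<^sup>+x. emeasure (P x \<bind> (\<lambda>y. return (\<mu> \<Otimes>\<^sub>M \<mu>) (x, y))) B \<partial>\<mu>)"
      unfolding joint_law_def by (intro emeasure_bind[where N="\<mu> \<Otimes>\<^sub>M \<mu>"] not_empty that) measurable
    also have "\<dots> = (\<integral>\<^sup>+x. \<integral>\<^sup>+y. indicator B (x, y) \<partial>P x \<partial>\<mu>)"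
    proof (rule nn_integral_cong)
      fix x assume x [measurable]: "x \<in> space \<mu>"
      have "(\<lambda>y. return (\<mu> \<Otimes>\<^sub>M \<mu>) (x, y)) \<in> \<mu> \<rightarrow>\<^sub>M subprob_algebra (\<mu> \<Otimes>\<^sub>M \<mu>)"
        by measurable
      then have "(\<lambda>y. return (\<mu> \<Otimes>\<^sub>M \<mu>) (x, y)) \<in> P x \<rightarrow>\<^sub>M subprob_algebra (\<mu> \<Otimes>\<^sub>M \<mu>)"
        using sets_P[OF x] by (simp cong: measurable_cong_sets)
      then have "emeasure (P x \<bind> (\<lambda>y. return (\<mu> \<Otimes>\<^sub>M \<mu>) (x, y))) B =
          (\<integral>\<^sup>+y. emeasure (return (\<mu> \<Otimes>\<^sub>M \<mu>) (x, y)) B \<partial>P x)"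
        using x not_empty by (intro emeasure_bind[where N="\<mu> \<Otimes>\<^sub>M \<mu>"] that) (auto simp: sets_eq_imp_space_eq[OF sets_P[OF x]])
      then show "emeasure (P x \<bind> (\<lambda>y. return (\<mu> \<Otimes>\<^sub>M \<mu>) (x, y))) B = (\<integral>\<^sup>+y. indicator B (x, y) \<partial>P x)"
        by simp
    qed
    finally show ?thesis .
  qed
  have sets_joint: "sets (joint_law \<mu> P) = sets (\<mu> \<Otimes>\<^sub>M \<mu>)"
    unfolding joint_law_def by (rule sets_bind[OF _ not_empty]) (simp add: sets_bind not_empty sets_P sets_eq_imp_space_eq[OF sets_P])
  show "sets (distr (joint_law \<mu> P) (\<mu> \<Otimes>\<^sub>M \<mu>) (\<lambda>(x, y). (y, x))) = sets (joint_law \<mu> P)"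
    by (simp add: sets_joint)
  fix B assume "B \<in> sets (distr (joint_law \<mu> P) (\<mu> \<Otimes>\<^sub>M \<mu>) (\<lambda>(x, y). (y, x)))"
  then have B [measurable]: "B \<in> sets (\<mu> \<Otimes>\<^sub>M \<mu>)" by simp
  have swap: "(\<lambda>(x, y). (y, x)) \<in> joint_law \<mu> P \<rightarrow>\<^sub>M \<mu> \<Otimes>\<^sub>M \<mu>"
    unfolding measurable_cong_sets[OF sets_joint refl] by measurable
  have "emeasure (distr (joint_law \<mu> P) (\<mu> \<Otimes>\<^sub>M \<mu>) (\<lambda>(x, y). (y, x))) B =
      emeasure (joint_law \<mu> P) ((\<lambda>(x, y). (y, x)) -` B \<inter> space (\<mu> \<Otimes>\<^sub>M \<mu>))"
    using B by (simp add: emeasure_distr[OF swap] sets_eq_imp_space_eq[OF sets_joint])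
  also have "\<dots> = (\<integral>\<^sup>+x. \<integral>\<^sup>+y. indicator ((\<lambda>(x, y). (y, x)) -` B \<inter> space (\<mu> \<Otimes>\<^sub>M \<mu>)) (x, y) \<partial>P x \<partial>\<mu>)"
    using B by (intro joint) measurable
  also have "\<dots> = (\<integral>\<^sup>+x. \<integral>\<^sup>+y. indicator B (y, x) \<partial>P x \<partial>\<mu>)"
    by (intro nn_integral_cong)
       (auto simp: indicator_def space_pair_measure sets_eq_imp_space_eq[OF sets_P])
  also have "\<dots> = (\<integral>\<^sup>+x. \<integral>\<^sup>+y. indicator B (x, y) \<partial>P x \<partial>\<mu>)"
    by (rule nn_integral_P_swap[of "\<lambda>x y. indicator B (x, y)"]) measurable
  also have "\<dots> = emeasure (joint_law \<mu> P) B"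
    by (rule joint[OF B, symmetric])
  finally show "emeasure (distr (joint_law \<mu> P) (\<mu> \<Otimes>\<^sub>M \<mu>) (\<lambda>(x, y). (y, x))) B = emeasure (joint_law \<mu> P) B" .
qed

lemmas dirichlet_form_P =
  dirichlet_form_invariant[OF prob_space_axioms markov_kernel _ invariant]

lemma dirichlet_form_eq:
  assumes f: "f \<in> L2 \<mu>"
  shows "ennreal (2 * dirichlet_form \<mu> P f) =
    (\<integral>\<^sup>+x. \<integral>\<^sup>+y. ennreal ((f x - f y)\<^sup>2) * k x y \<partial>\<mu> \<partial>\<mu>)"
proof -
  have [measurable]: "f \<in> borel_measurable \<mu>" using f by (simp add: L2_def)
  have "ennreal (2 * dirichlet_form \<mu> P f) = (\<integral>\<^sup>+x. \<integral>\<^sup>+y. ennreal ((f x - f y)\<^sup>2) \<partial>P x \<partial>\<mu>)"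
    using f by (rule dirichlet_form_P)
  also have "\<dots> = (\<integral>\<^sup>+x. \<integral>\<^sup>+y. ennreal ((f x - f y)\<^sup>2) * k x y \<partial>\<mu> \<partial>\<mu>)"
    \<comment> \<open>The holding term is evaluated at \<open>y = x\<close>, where the squared
      difference vanishes.\<close>
    by (intro nn_integral_cong) (subst nn_integral_P, auto)
  finally show ?thesis .
qed

end

section \<open>Oscillation bound across measures, and the weak Poincare inequality for constant
  densities\<close>

text \<open>The last hypothesis is absolute continuity of \<open>\<rho>\<close> with respect to
  \<open>\<mu>\<close>, so almost sure bounds under \<open>\<mu>\<close> pass to
  \<open>\<rho>\<close>. It serves to bound the energy under a level measure by the oscillation
  under the target.\<close>

lemma nn_integral_square_diff_le_osc_AE:
  fixes f :: "'a \<Rightarrow> real"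
  assumes "prob_space \<rho>" "f \<in> borel_measurable \<rho>" "f \<in> borel_measurable \<mu>"
    and AE: "\<And>Q. (AE x in \<mu>. Q x) \<Longrightarrow> (AE x in \<rho>. Q x)"
  shows "(\<integral>\<^sup>+x. \<integral>\<^sup>+y. ennreal ((f x - f y)\<^sup>2) \<partial>\<rho> \<partial>\<rho>) \<le> e2ennreal ((osc \<mu> f)\<^sup>2) / 2"
proof (rule osc_square_cases[OF assms(3)])
  assume "(osc \<mu> f)\<^sup>2 = \<infinity>"
  then show ?thesis by (simp add: e2ennreal_infty ennreal_top_divide)
next
  fix a b assume *: "AE x in \<mu>. f x \<in> {a..b}" "(osc \<mu> f)\<^sup>2 = ereal ((b - a)\<^sup>2)"
  have "(\<integral>\<^sup>+x. \<integral>\<^sup>+y. ennreal ((f x - f y)\<^sup>2) \<partial>\<rho> \<partial>\<rho>) \<le> ennreal ((b - a)\<^sup>2 / 2)"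
    using assms(1,2) AE[OF *(1)] by (rule prob_space.nn_integral_square_diff_le_osc)
  then show ?thesis
    by (simp add: *(2) e2ennreal_ereal divide_ennreal[symmetric])
qed

text \<open>Such a kernel resamples from \<open>\<mu>\<close> with probability \<open>m\<close> and
  otherwise stays, so its Dirichlet form is \<open>m * variance f\<close>. For
  \<open>s >= 1 / m\<close> the form alone controls the variance; for smaller \<open>s\<close>
  Popoviciu's inequality does, which explains the 1/4. Positivity holds since
  \<open>m * variance f\<close> is at most the squared norm.\<close>

lemma weak_poincare_constant_kernel:
  assumes "symmetric_kernel \<mu> (\<lambda>_ _. ennreal m) P" and m: "0 < m" "m \<le> 1"
  shows "weak_poincare \<mu> P (\<lambda>s. 1 / 4 * indicator {0<..<1 / m} s)"
proof -
  interpret symmetric_kernel \<mu> "\<lambda>_ _. ennreal m" P by fact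
  have dirichlet: "dirichlet_form \<mu> P f = m * variance f" if f: "f \<in> L2 \<mu>" for f
  proof -
    have [measurable]: "f \<in> borel_measurable \<mu>" using f by (simp add: L2_def)
    have "ennreal (2 * dirichlet_form \<mu> P f) = ennreal (2 * variance f) * ennreal m"
      unfolding dirichlet_form_eq[OF f] nn_integral_square_diff[OF f, symmetric]
      by (simp add: nn_integral_multc)
    also have "\<dots> = ennreal (2 * (m * variance f))"
      using m by (simp add: ennreal_mult[symmetric] mult_ac)
    finally show ?thesis
      using dirichlet_form_P(2)[OF f] m by (subst (asm) ennreal_inj) auto
  qed
  have var: "variance f = (L2_norm \<mu> f)\<^sup>2 - (expectation f)\<^sup>2" if f: "f \<in> L2 \<mu>" for f
  proof -
    have [measurable]: "f \<in> borel_measurable \<mu>" and f2: "integrable \<mu> (\<lambda>x. (f x)\<^sup>2)"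
      using f by (auto simp: L2_def)
    show ?thesis
      using square_integrable_imp_integrable[OF _ f2] f2
      by (subst variance_eq) (simp_all add: L2_norm_def L2_inner_def power2_eq_square[symmetric])
  qed
  show ?thesis
    unfolding weak_poincare_def
  proof (intro conjI allI ballI impI)
    show "prob_space \<mu>" by (rule prob_space_axioms)
    show "markov_kernel \<mu> P" "reversible \<mu> P"
      by (fact markov_kernel reversible)+
    show "antimono_on {0<..} (\<lambda>s. 1 / 4 * indicator {0<..<1 / m} s :: real)"
      by (auto simp: monotone_on_def indicator_def)
    have "eventually (\<lambda>s. 1 / 4 * indicator {0<..<1 / m} s = (0::real)) at_top"
      using eventually_ge_at_top[of "1 / m"] by eventually_elim simp
    then show "((\<lambda>s. 1 / 4 * indicator {0<..<1 / m} s :: real) \<longlongrightarrow> 0) at_top"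
      by (rule tendsto_eventually)
    show "positive_kernel \<mu> P"
      unfolding positive_kernel_def
    proof
      fix f assume f: "f \<in> L2 \<mu>"
      have "m * variance f \<le> 1 * variance f"
        using m by (intro mult_right_mono) auto
      also have "\<dots> \<le> (L2_norm \<mu> f)\<^sup>2"
        using var[OF f] by simp
      finally show "0 \<le> L2_inner \<mu> (kernel_op P f) f"
        using dirichlet_form_P(1)[OF f] dirichlet[OF f] by simp
    qed
    fix s :: real assume s: "0 < s"
    show "0 \<le> (1 / 4 * indicator {0<..<1 / m} s :: real)"
      by simp
    fix f assume "f \<in> L2_0 \<mu>"
    then have f: "f \<in> L2 \<mu>" and "expectation f = 0"
      by (auto simp: L2_0_def)
    then have norm: "(L2_norm \<mu> f)\<^sup>2 = variance f"
      using var[OF f] by simp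
    from f have [measurable]: "f \<in> borel_measurable \<mu>" by (simp add: L2_def)
    show "ereal ((L2_norm \<mu> f)\<^sup>2) \<le> ereal (s * dirichlet_form \<mu> P f)
        + ereal (1 / 4 * indicator {0<..<1 / m} s) * (osc \<mu> f)\<^sup>2"
    proof (cases "s < 1 / m")
      case False
      then have "1 * variance f \<le> s * m * variance f"
        using m by (intro mult_right_mono) (auto simp: field_simps)
      \<comment> \<open>The coefficient of the oscillation is now 0, and the product is 0 even for
        infinite oscillation.\<close>
      then show ?thesis
        using False by (simp add: norm dirichlet[OF f] zero_ereal_def[symmetric])
    next
      case True
      have sd: "0 \<le> s * dirichlet_form \<mu> P f"
        using s dirichlet_form_P(2)[OF f] by simp
      show ?thesis
      proof (rule osc_square_cases[of f \<mu>])
        assume "(osc \<mu> f)\<^sup>2 = \<infinity>"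
        then show ?thesis using True s by simp
      next
        fix a b assume *: "AE x in \<mu>. f x \<in> {a..b}" "(osc \<mu> f)\<^sup>2 = ereal ((b - a)\<^sup>2)"
        have "ennreal (2 * variance f) \<le> ennreal ((b - a)\<^sup>2 / 2)"
          unfolding nn_integral_square_diff[OF f, symmetric]
          using *(1) by (intro nn_integral_square_diff_le_osc) auto
        then have "variance f \<le> (b - a)\<^sup>2 / 4"
          by (subst (asm) ennreal_le_iff) auto
        then show ?thesis
          using True s sd by (simp add: norm *(2))
      qed simp
    qed
  qed
qed

section \<open>Level sets and the kernels on them\<close>

lemma level_set_measurable [measurable]:
  "w \<in> borel_measurable \<nu> \<Longrightarrow> level_set \<nu> w t \<in> sets \<nu>"
  by (simp add: level_set_def)

locale weighted_prob_space = prob_space \<nu> for \<nu> :: "'a measure" +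
  fixes w :: "'a \<Rightarrow> real"
  assumes w_measurable [measurable]: "w \<in> borel_measurable \<nu>"
    and w_pos: "x \<in> space \<nu> \<Longrightarrow> 0 < w x"
    and w_integrable: "integrable \<nu> w"
    and normalizer_pos: "0 < normalizer \<nu> w"
    and sup_weight: "sup_weight \<nu> w = esssup \<nu> (\<lambda>x. ereal (w x))"
begin

text \<open>Here the equality of supremum and essential supremum acts: a level strictly between the
  two would have a nonempty null level set.\<close>

lemma level_mass_pos:
  assumes "t \<in> levels \<nu> w"
  shows "0 < level_mass \<nu> w t"
proof -
  have "0 < emeasure \<nu> {x \<in> space \<nu>. ereal t < ereal (w x)}"
    using assms by (intro esssup_pos_measure) (auto simp: levels_def sup_weight)
  then show ?thesis
    by (simp add: level_mass_def level_set_def emeasure_eq_measure)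
qed

lemma in_levels: "0 < t \<Longrightarrow> t < w x \<Longrightarrow> x \<in> space \<nu> \<Longrightarrow> t \<in> levels \<nu> w"
  unfolding levels_def sup_weight_def by (auto simp: less_SUP_iff)

lemma level_set_empty: "0 < t \<Longrightarrow> t \<notin> levels \<nu> w \<Longrightarrow> level_set \<nu> w t = {}"
  using in_levels by (auto simp: level_set_def)

lemma prob_space_level_measure: "t \<in> levels \<nu> w \<Longrightarrow> prob_space (level_measure \<nu> w t)"
  using level_mass_pos[of t] unfolding level_measure_def
  by (intro prob_space_uniform_measure) (auto simp: level_mass_def emeasure_eq_measure)

text \<open>On the level set, \<open>\<nu>\<close> has the constant density
  \<open>level_mass \<nu> w t\<close> with respect to its normalised restriction, and the holding
  probability is the complement of that constant.\<close>

lemma symmetric_kernel_level_kernel: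
  assumes t: "t \<in> levels \<nu> w"
  shows "symmetric_kernel (restrict_space (level_measure \<nu> w t) (level_set \<nu> w t))
    (\<lambda>_ _. ennreal (level_mass \<nu> w t)) (level_kernel \<nu> w t)"
proof -
  let ?G = "level_set \<nu> w t" and ?m = "level_mass \<nu> w t"
  let ?R = "restrict_space (level_measure \<nu> w t) ?G"
  have m: "0 < ?m" using t by (rule level_mass_pos)
  have sets_R: "sets ?R = sets (restrict_space \<nu> ?G)"
    by (simp add: level_measure_def sets_restrict_space)
  have G_sub: "?G \<subseteq> space \<nu>" by (auto simp: level_set_def)
  have R: "emeasure ?R A = emeasure \<nu> A / ennreal ?m" "A \<inter> ?G = A" "A \<in> sets \<nu>" if "A \<in> sets ?R" for A
  proof -
    show A: "A \<inter> ?G = A" "A \<in> sets \<nu>"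
      using that unfolding sets_R by (auto simp: sets_restrict_space)
    then show "emeasure ?R A = emeasure \<nu> A / ennreal ?m"
      by (subst emeasure_restrict_space)
         (auto simp: level_measure_def level_mass_def emeasure_eq_measure Int_commute)
  qed
  have "prob_space ?R"
  proof (rule prob_space_restrict_space)
    show "emeasure (level_measure \<nu> w t) ?G = 1"
      using m by (simp add: level_measure_def level_mass_def emeasure_eq_measure ennreal_divide_self)
  qed (simp add: level_measure_def)
  then interpret R: prob_space ?R .
  have space_R: "space ?R = ?G"
    using G_sub by (auto simp: level_measure_def space_restrict_space)
  show ?thesis
  proof unfold_locales
    fix x
    show "(\<integral>\<^sup>+y. ennreal ?m \<partial>?R) \<le> 1"
      by (simp add: R.emeasure_space_1 level_mass_def)
    show "sets (level_kernel \<nu> w t x) = sets ?R"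
      using sets.sigma_sets_eq[of "restrict_space \<nu> ?G"] sets.space_closed[of "restrict_space \<nu> ?G"] G_sub
      unfolding sets_R level_kernel_def Let_def
      by (simp add: space_restrict_space Int_absorb2)
    fix A assume A: "A \<in> sets ?R"
    have "(\<integral>\<^sup>+y\<in>A. ennreal ?m \<partial>?R) = emeasure \<nu> A"
      using m by (simp only: nn_integral_cmult_indicator[OF A] R(1)[OF A])
        (simp add: emeasure_eq_measure divide_ennreal ennreal_mult'[symmetric])
    then show "emeasure (level_kernel \<nu> w t x) A =
        (\<integral>\<^sup>+y\<in>A. ennreal ?m \<partial>?R) + indicator A x * (1 - (\<integral>\<^sup>+y. ennreal ?m \<partial>?R))"
      using A R(2)[OF A] unfolding sets_R
      by (simp add: emeasure_level_kernel R.emeasure_space_1 level_mass_def emeasure_eq_measure)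
  qed auto
qed

lemma weak_poincare_level_kernel:
  "t \<in> levels \<nu> w \<Longrightarrow>
    weak_poincare (restrict_space (level_measure \<nu> w t) (level_set \<nu> w t)) (level_kernel \<nu> w t)
      (\<lambda>s. 1 / 4 * indicator {0<..<1 / level_mass \<nu> w t} s)"
  using level_mass_pos symmetric_kernel_level_kernel
  by (intro weak_poincare_constant_kernel) (auto simp: level_mass_def)

section \<open>Layer-cake densities and Fubini over the levels\<close>

sublocale nu_lborel: pair_sigma_finite \<nu> lborel ..

text \<open>Layer-cake weights: \<open>q = 1\<close> gives the minimum of the two weights (Metropolis), and
  \<open>q = 1 / level_mass\<close> gives slice sampling.\<close>

definition layer_density :: "(real \<Rightarrow> ennreal) \<Rightarrow> 'a \<Rightarrow> 'a \<Rightarrow> ennreal" where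
  "layer_density q x y = (\<integral>\<^sup>+t. (if 0 < t \<and> t < w x \<and> t < w y then q t else 0) \<partial>lborel)"

text \<open>The \<open>D t\<close> from the overview, with the level set as a cut-off condition in
  the integrand: this is jointly measurable in \<open>t\<close>, \<open>x\<close>, \<open>y\<close>,
  as Fubini requires.\<close>

definition level_energy :: "('a \<Rightarrow> real) \<Rightarrow> real \<Rightarrow> ennreal" where
  "level_energy f t =
    (\<integral>\<^sup>+x. \<integral>\<^sup>+y. (if t < w x \<and> t < w y then ennreal ((f x - f y)\<^sup>2) else 0) \<partial>\<nu> \<partial>\<nu>)"

lemma layer_density_sym: "layer_density q x y = layer_density q y x"
  by (simp add: layer_density_def conj_commute)

lemma layer_density_measurable [measurable]:
  assumes [measurable]: "q \<in> borel_measurable borel"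
  shows "(\<lambda>(x, y). layer_density q x y) \<in> borel_measurable (\<nu> \<Otimes>\<^sub>M \<nu>)"
  unfolding layer_density_def by measurable

lemma emeasure_level_set_measurable [measurable]:
  "(\<lambda>t. emeasure \<nu> (level_set \<nu> w t)) \<in> borel_measurable borel"
proof -
  have "emeasure \<nu> (level_set \<nu> w t) = (\<integral>\<^sup>+x. (if t < w x then 1 else 0) \<partial>\<nu>)" for t
  proof -
    have "emeasure \<nu> (level_set \<nu> w t) = (\<integral>\<^sup>+x. indicator (level_set \<nu> w t) x \<partial>\<nu>)"
      by simp
    also have "\<dots> = (\<integral>\<^sup>+x. (if t < w x then 1 else 0) \<partial>\<nu>)"
      by (intro nn_integral_cong) (auto simp: level_set_def)
    finally show ?thesis .
  qed
  then show ?thesis by simp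
qed

lemma level_energy_measurable [measurable]:
  assumes [measurable]: "f \<in> borel_measurable \<nu>"
  shows "level_energy f \<in> borel_measurable borel"
  unfolding level_energy_def[abs_def] by measurable

text \<open>Fubini between points and levels. Taking \<open>h\<close> as 1, an indicator or a
  squared difference gives the total mass, the value on a set and the energy.\<close>

lemma nn_integral_layer_density:
  assumes [measurable]: "q \<in> borel_measurable borel" "h \<in> borel_measurable \<nu>"
  shows "(\<integral>\<^sup>+y. h y * layer_density q x y \<partial>\<nu>) =
    (\<integral>\<^sup>+t. (if 0 < t \<and> t < w x then q t * (\<integral>\<^sup>+y. h y * indicator (level_set \<nu> w t) y \<partial>\<nu>) else 0) \<partial>lborel)"
proof -
  have "(\<integral>\<^sup>+y. h y * layer_density q x y \<partial>\<nu>) =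
      (\<integral>\<^sup>+y. \<integral>\<^sup>+t. h y * (if 0 < t \<and> t < w x \<and> t < w y then q t else 0) \<partial>lborel \<partial>\<nu>)"
    unfolding layer_density_def by (intro nn_integral_cong nn_integral_cmult[symmetric]) measurable
  also have "\<dots> = (\<integral>\<^sup>+t. \<integral>\<^sup>+y. h y * (if 0 < t \<and> t < w x \<and> t < w y then q t else 0) \<partial>\<nu> \<partial>lborel)"
    by (rule nu_lborel.Fubini'[symmetric]) measurable
  also have "\<dots> = (\<integral>\<^sup>+t. (if 0 < t \<and> t < w x
      then q t * (\<integral>\<^sup>+y. h y * indicator (level_set \<nu> w t) y \<partial>\<nu>) else 0) \<partial>lborel)"
  proof (rule nn_integral_cong)
    fix t
    have "(\<integral>\<^sup>+y. h y * (if 0 < t \<and> t < w x \<and> t < w y then q t else 0) \<partial>\<nu>) =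
        (\<integral>\<^sup>+y. (if 0 < t \<and> t < w x then q t else 0) * (h y * indicator (level_set \<nu> w t) y) \<partial>\<nu>)"
      by (intro nn_integral_cong) (auto simp: level_set_def mult.commute)
    also have "\<dots> = (if 0 < t \<and> t < w x then q t else 0) * (\<integral>\<^sup>+y. h y * indicator (level_set \<nu> w t) y \<partial>\<nu>)"
      by (rule nn_integral_cmult) measurable
    finally show "(\<integral>\<^sup>+y. h y * (if 0 < t \<and> t < w x \<and> t < w y then q t else 0) \<partial>\<nu>) =
        (if 0 < t \<and> t < w x then q t * (\<integral>\<^sup>+y. h y * indicator (level_set \<nu> w t) y \<partial>\<nu>) else 0)"
      by simp
  qed
  finally show ?thesis .
qed

lemma layer_density_mass:
  assumes [measurable]: "q \<in> borel_measurable borel"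
  shows "(\<integral>\<^sup>+y. layer_density q x y \<partial>\<nu>) =
    (\<integral>\<^sup>+t. (if 0 < t \<and> t < w x then q t * emeasure \<nu> (level_set \<nu> w t) else 0) \<partial>lborel)"
  using nn_integral_layer_density[of q "\<lambda>_. 1" x] by (simp cong: if_cong)

lemma nn_integral_below_weight:
  "x \<in> space \<nu> \<Longrightarrow> (\<integral>\<^sup>+t. (if 0 < t \<and> t < w x then 1 else 0) \<partial>lborel) = ennreal (w x)"
proof -
  assume "x \<in> space \<nu>"
  have "(\<integral>\<^sup>+t. (if 0 < t \<and> t < w x then 1 else 0) \<partial>lborel) = (\<integral>\<^sup>+t. indicator {0<..<w x} t \<partial>lborel)"
    by (intro nn_integral_cong) auto
  then show ?thesis
    using w_pos[OF \<open>x \<in> space \<nu>\<close>] by simp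
qed

text \<open>A second exchange moves the level outside \<open>x\<close> as well; \<open>q t\<close>
  then leaves the inner integrals since it depends on the level alone.\<close>

lemma layer_energy:
  assumes [measurable]: "q \<in> borel_measurable borel" "f \<in> borel_measurable \<nu>"
  shows "(\<integral>\<^sup>+x. \<integral>\<^sup>+y. ennreal ((f x - f y)\<^sup>2) * layer_density q x y \<partial>\<nu> \<partial>\<nu>) =
    (\<integral>\<^sup>+t. indicator {0<..} t * (q t * level_energy f t) \<partial>lborel)"
proof -
  let ?F = "\<lambda>x y. ennreal ((f x - f y)\<^sup>2)"
  have "(\<integral>\<^sup>+x. \<integral>\<^sup>+y. ?F x y * layer_density q x y \<partial>\<nu> \<partial>\<nu>) =
      (\<integral>\<^sup>+x. \<integral>\<^sup>+t. (if 0 < t \<and> t < w x then q t * (\<integral>\<^sup>+y. ?F x y * indicator (level_set \<nu> w t) y \<partial>\<nu>) else 0) \<partial>lborel \<partial>\<nu>)"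
    by (intro nn_integral_cong nn_integral_layer_density) measurable
  also have "\<dots> = (\<integral>\<^sup>+x. \<integral>\<^sup>+t. indicator {0<..} t * (q t *
      (\<integral>\<^sup>+y. (if t < w x \<and> t < w y then ?F x y else 0) \<partial>\<nu>)) \<partial>lborel \<partial>\<nu>)"
    by (intro nn_integral_cong)
       (auto simp: level_set_def indicator_def if_distrib intro!: arg_cong2[where f="(*)"] nn_integral_cong)
  also have "\<dots> = (\<integral>\<^sup>+t. \<integral>\<^sup>+x. indicator {0<..} t * (q t *
      (\<integral>\<^sup>+y. (if t < w x \<and> t < w y then ?F x y else 0) \<partial>\<nu>)) \<partial>\<nu> \<partial>lborel)"
    by (rule nu_lborel.Fubini'[symmetric]) measurable
  also have "\<dots> = (\<integral>\<^sup>+t. indicator {0<..} t * (q t * level_energy f t) \<partial>lborel)"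
    unfolding level_energy_def by (intro nn_integral_cong) (simp add: nn_integral_cmult)
  finally show ?thesis .
qed

section \<open>The target measure and the Dirichlet forms of both kernels\<close>

abbreviation (input) c :: real where "c \<equiv> normalizer \<nu> w"

lemma nn_integral_target:
  assumes "h \<in> borel_measurable \<nu>"
  shows "(\<integral>\<^sup>+x. h x \<partial>target \<nu> w) = (\<integral>\<^sup>+x. ennreal (w x / c) * h x \<partial>\<nu>)"
  unfolding target_def using assms by (intro nn_integral_density) auto

lemma sets_target [simp, measurable_cong]: "sets (target \<nu> w) = sets \<nu>"
  by (simp add: target_def)

lemma space_target [simp]: "space (target \<nu> w) = space \<nu>"
  by (simp add: target_def)

lemma prob_space_target: "prob_space (target \<nu> w)"
proof
  have "(\<integral>\<^sup>+x. ennreal (w x / c) \<partial>\<nu>) = ennreal (\<integral>x. w x / c \<partial>\<nu>)"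
    using w_integrable w_pos normalizer_pos by (intro nn_integral_eq_integral AE_I2) (auto intro!: less_imp_le)
  also have "(\<integral>x. w x / c \<partial>\<nu>) = 1"
    using normalizer_pos by (simp add: normalizer_def)
  finally show "emeasure (target \<nu> w) (space (target \<nu> w)) = 1"
    by (simp add: target_def emeasure_density cong: nn_integral_cong)
qed

text \<open>The density of the target vanishes nowhere, so both measures have the same null
  sets.\<close>

lemma AE_target: "(AE x in target \<nu> w. Q x) \<longleftrightarrow> (AE x in \<nu>. Q x)"
  unfolding target_def using w_pos normalizer_pos
  by (subst AE_density) (auto intro!: AE_cong)

text \<open>Common form of Metropolis and slice sampling: density
  \<open>layer_density q x y / w x\<close> with respect to \<open>\<nu>\<close>, the missing mass
  placed at \<open>x\<close>. The bound on \<open>q\<close> keeps the mass at most 1, because the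
  levels below \<open>w x\<close> have total length \<open>w x\<close>.\<close>

lemma layer_kernel:
  fixes P :: "'a \<Rightarrow> 'a measure"
  assumes q [measurable]: "q \<in> borel_measurable borel"
    and q_le: "\<And>t. t \<in> levels \<nu> w \<Longrightarrow> q t * emeasure \<nu> (level_set \<nu> w t) \<le> 1"
    and sets_P: "\<And>x. x \<in> space \<nu> \<Longrightarrow> sets (P x) = sets \<nu>"
    and P: "\<And>x A. x \<in> space \<nu> \<Longrightarrow> A \<in> sets \<nu> \<Longrightarrow> emeasure (P x) A =
      (\<integral>\<^sup>+y\<in>A. layer_density q x y / ennreal (w x) \<partial>\<nu>)
        + indicator A x * (1 - (\<integral>\<^sup>+y. layer_density q x y / ennreal (w x) \<partial>\<nu>))"
    and f: "f \<in> L2 (target \<nu> w)"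
  shows "0 \<le> dirichlet_form (target \<nu> w) P f"
    and "ennreal (2 * c * dirichlet_form (target \<nu> w) P f) =
      (\<integral>\<^sup>+t. indicator {0<..} t * (q t * level_energy f t) \<partial>lborel)"
proof -
  let ?\<pi> = "target \<nu> w"
  \<comment> \<open>The density with respect to \<open>\<nu>\<close> divided by the target density
    \<open>w y / c\<close>; this makes it symmetric.\<close>
  let ?k = "\<lambda>x y. layer_density q x y * ennreal (c / (w x * w y))"
  interpret pi: prob_space ?\<pi> by (rule prob_space_target)
  have f_meas [measurable]: "f \<in> borel_measurable \<nu>"
    using f by (simp add: L2_def cong: measurable_cong_sets)
  have pull: "ennreal (w y / c) * (g * ?k x y) = g * (layer_density q x y / ennreal (w x))"
    if "x \<in> space \<nu>" "y \<in> space \<nu>" for x y g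
  proof -
    note pos = w_pos[OF that(1)] w_pos[OF that(2)] normalizer_pos
    have "ennreal (w y / c) * ennreal (c / (w x * w y)) = ennreal (w y / c * (c / (w x * w y)))"
      using pos by (intro ennreal_mult[symmetric]) auto
    also have "w y / c * (c / (w x * w y)) = 1 / w x"
      using pos by simp
    also have "ennreal (1 / w x) = 1 / ennreal (w x)"
      using divide_ennreal[of 1 "w x"] pos by simp
    finally have "ennreal (w y / c) * ennreal (c / (w x * w y)) = 1 / ennreal (w x)" .
    then show ?thesis
      by (simp add: ac_simps divide_ennreal_def)
  qed
  have sec [measurable]: "layer_density q x \<in> borel_measurable \<nu>" if "x \<in> space \<nu>" for x
    using measurable_compose[OF measurable_Pair1'[OF that] layer_density_measurable[OF q]] by simp
  have target: "(\<integral>\<^sup>+y. g y * ?k x y \<partial>?\<pi>) = (\<integral>\<^sup>+y. g y * (layer_density q x y / ennreal (w x)) \<partial>\<nu>)"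
    if x [measurable]: "x \<in> space \<nu>" and [measurable]: "g \<in> borel_measurable \<nu>" for x g
    using x by (subst nn_integral_target) (auto intro!: nn_integral_cong simp: pull)
  interpret symmetric_kernel ?\<pi> ?k P
  proof unfold_locales
    show "(\<lambda>(x, y). ?k x y) \<in> borel_measurable (?\<pi> \<Otimes>\<^sub>M ?\<pi>)"
      by measurable
    show "?k x y = ?k y x" for x y
      by (simp add: layer_density_sym mult.commute)
    fix x assume "x \<in> space ?\<pi>"
    then have x: "x \<in> space \<nu>" by simp
    have "(\<integral>\<^sup>+y. ?k x y \<partial>?\<pi>) = (\<integral>\<^sup>+y. layer_density q x y \<partial>\<nu>) / ennreal (w x)"
      using target[OF x, of "\<lambda>_. 1"] x by (simp add: nn_integral_divide)
    also have "\<dots> \<le> (\<integral>\<^sup>+t. (if 0 < t \<and> t < w x then 1 else 0) \<partial>lborel) / ennreal (w x)"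
      unfolding layer_density_mass[OF q] using q_le in_levels x
      by (intro divide_right_mono_ennreal nn_integral_mono) auto
    also have "\<dots> = 1"
      using w_pos[OF x] by (simp add: nn_integral_below_weight[OF x] ennreal_divide_self)
    finally show "(\<integral>\<^sup>+y. ?k x y \<partial>?\<pi>) \<le> 1" .
    show "sets (P x) = sets ?\<pi>"
      using sets_P[OF x] by simp
    fix A assume "A \<in> sets ?\<pi>"
    then have A [measurable]: "A \<in> sets \<nu>" by simp
    show "emeasure (P x) A = (\<integral>\<^sup>+y\<in>A. ?k x y \<partial>?\<pi>) + indicator A x * (1 - (\<integral>\<^sup>+y. ?k x y \<partial>?\<pi>))"
      using target[OF x, of "\<lambda>_. 1"] target[OF x, of "indicator A"] P[OF x A]
      by (simp add: mult.commute)
  qed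
  show nonneg: "0 \<le> dirichlet_form ?\<pi> P f"
    using f by (rule dirichlet_form_P)
  let ?F = "\<lambda>x y. ennreal ((f x - f y)\<^sup>2)"
  \<comment> \<open>The factor \<open>1 / c\<close> from integrating \<open>y\<close> cancels inside
    \<open>?k\<close>; the one from integrating \<open>x\<close> is absorbed by the \<open>c\<close>
    in front of the form.\<close>
  have cc: "ennreal c * ennreal (w x / c) = ennreal (w x)" if "x \<in> space \<nu>" for x
    using normalizer_pos w_pos[OF that] by (simp add: ennreal_mult[symmetric])
  have "ennreal (2 * c * dirichlet_form ?\<pi> P f) = ennreal c * ennreal (2 * dirichlet_form ?\<pi> P f)"
    using normalizer_pos nonneg by (simp add: ennreal_mult[symmetric] mult_ac)
  also have "\<dots> = ennreal c * (\<integral>\<^sup>+x. \<integral>\<^sup>+y. ?F x y * ?k x y \<partial>?\<pi> \<partial>?\<pi>)"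
    unfolding dirichlet_form_eq[OF f] ..
  also have "(\<integral>\<^sup>+x. \<integral>\<^sup>+y. ?F x y * ?k x y \<partial>?\<pi> \<partial>?\<pi>) =
      (\<integral>\<^sup>+x. \<integral>\<^sup>+y. ?F x y * (layer_density q x y / ennreal (w x)) \<partial>\<nu> \<partial>?\<pi>)"
    by (intro nn_integral_cong target) auto
  also have "\<dots> = (\<integral>\<^sup>+x. ennreal (w x / c) * (\<integral>\<^sup>+y. ?F x y * (layer_density q x y / ennreal (w x)) \<partial>\<nu>) \<partial>\<nu>)"
    by (rule nn_integral_target) measurable
  also have "ennreal c * \<dots> = (\<integral>\<^sup>+x. ennreal c *
      (ennreal (w x / c) * (\<integral>\<^sup>+y. ?F x y * (layer_density q x y / ennreal (w x)) \<partial>\<nu>)) \<partial>\<nu>)"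
    by (rule nn_integral_cmult[symmetric]) measurable
  also have "\<dots> = (\<integral>\<^sup>+x. \<integral>\<^sup>+y. ?F x y * layer_density q x y \<partial>\<nu> \<partial>\<nu>)"
  proof (rule nn_integral_cong)
    fix x assume x: "x \<in> space \<nu>"
    have "ennreal c * (ennreal (w x / c) * (\<integral>\<^sup>+y. ?F x y * (layer_density q x y / ennreal (w x)) \<partial>\<nu>)) =
        ennreal (w x) * (\<integral>\<^sup>+y. ?F x y * (layer_density q x y / ennreal (w x)) \<partial>\<nu>)"
      by (simp add: mult.assoc[symmetric] cc[OF x])
    also have "\<dots> = (\<integral>\<^sup>+y. ennreal (w x) * (?F x y * (layer_density q x y / ennreal (w x))) \<partial>\<nu>)"
      using x by (intro nn_integral_cmult[symmetric]) measurable
    also have "\<dots> = (\<integral>\<^sup>+y. ?F x y * layer_density q x y \<partial>\<nu>)"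
    proof (rule nn_integral_cong)
      fix y
      have "ennreal (w x) * (1 / ennreal (w x)) = 1"
        using w_pos[OF x] by (simp add: ennreal_times_divide ennreal_divide_self)
      then show "ennreal (w x) * (?F x y * (layer_density q x y / ennreal (w x))) = ?F x y * layer_density q x y"
        by (simp add: divide_ennreal_def mult_ac) (simp add: mult.assoc[symmetric])
    qed
    finally show "ennreal c * (ennreal (w x / c) * (\<integral>\<^sup>+y. ?F x y * (layer_density q x y / ennreal (w x)) \<partial>\<nu>)) =
        (\<integral>\<^sup>+y. ?F x y * layer_density q x y \<partial>\<nu>)" .
  qed
  also have "\<dots> = (\<integral>\<^sup>+t. indicator {0<..} t * (q t * level_energy f t) \<partial>lborel)"
    by (rule layer_energy) measurable
  finally show "ennreal (2 * c * dirichlet_form ?\<pi> P f) =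
      (\<integral>\<^sup>+t. indicator {0<..} t * (q t * level_energy f t) \<partial>lborel)" .
qed

lemma layer_density_one:
  assumes "x \<in> space \<nu>" "y \<in> space \<nu>"
  shows "layer_density (\<lambda>_. 1) x y = ennreal (min (w x) (w y))"
proof -
  have "layer_density (\<lambda>_. 1) x y = (\<integral>\<^sup>+t. indicator {0<..<min (w x) (w y)} t \<partial>lborel)"
    unfolding layer_density_def by (intro nn_integral_cong) auto
  then show ?thesis
    using w_pos[OF assms(1)] w_pos[OF assms(2)] by simp
qed

text \<open>\<open>min (w x) (w y) / w x\<close> is the acceptance probability, so
  \<open>q = 1\<close> fits, its mass condition being that level sets have measure at most
  1.\<close>

lemma metropolis_dirichlet_form:
  assumes f: "f \<in> L2 (target \<nu> w)"
  shows "0 \<le> dirichlet_form (target \<nu> w) (metropolis_kernel \<nu> w) f"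
    and "ennreal (2 * c * dirichlet_form (target \<nu> w) (metropolis_kernel \<nu> w) f) =
      (\<integral>\<^sup>+t. indicator {0<..} t * level_energy f t \<partial>lborel)"
proof -
  have sets: "sets (metropolis_kernel \<nu> w x) = sets \<nu>" for x
    by (simp add: metropolis_kernel_def)
  have accept: "layer_density (\<lambda>_. 1) x y / ennreal (w x) = ennreal (accept_prob w x y)"
    if "x \<in> space \<nu>" "y \<in> space \<nu>" for x y
    using w_pos[OF that(1)] w_pos[OF that(2)]
    by (simp add: layer_density_one[OF that] accept_prob_def divide_ennreal min_def field_simps)
  have "emeasure (metropolis_kernel \<nu> w x) A =
      (\<integral>\<^sup>+y\<in>A. layer_density (\<lambda>_. 1) x y / ennreal (w x) \<partial>\<nu>)
        + indicator A x * (1 - (\<integral>\<^sup>+y. layer_density (\<lambda>_. 1) x y / ennreal (w x) \<partial>\<nu>))"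
    if "x \<in> space \<nu>" "A \<in> sets \<nu>" for x A
    using that by (simp add: emeasure_metropolis_kernel accept cong: nn_integral_cong)
  note * = layer_kernel[where q="\<lambda>_. 1", OF _ _ sets this f]
  show "0 \<le> dirichlet_form (target \<nu> w) (metropolis_kernel \<nu> w) f"
    by (rule *(1)) (auto simp: emeasure_le_1)
  show "ennreal (2 * c * dirichlet_form (target \<nu> w) (metropolis_kernel \<nu> w) f) =
      (\<integral>\<^sup>+t. indicator {0<..} t * level_energy f t \<partial>lborel)"
    by (subst *(2)) (auto simp: emeasure_le_1)
qed

text \<open>With \<open>q\<close> the inverse level mass the mass condition is an equality, so the
  density integrates to 1 and the holding term disappears.\<close>

lemma slice_dirichlet_form:
  assumes f: "f \<in> L2 (target \<nu> w)"
  shows "0 \<le> dirichlet_form (target \<nu> w) (slice_kernel \<nu> w) f"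
    and "ennreal (2 * c * dirichlet_form (target \<nu> w) (slice_kernel \<nu> w) f) =
      (\<integral>\<^sup>+t. indicator {0<..} t * (inverse (emeasure \<nu> (level_set \<nu> w t)) * level_energy f t) \<partial>lborel)"
proof -
  define q where "q = (\<lambda>t. inverse (emeasure \<nu> (level_set \<nu> w t)))"
  have q [measurable]: "q \<in> borel_measurable borel"
    unfolding q_def by measurable
  have q_mass: "q t * emeasure \<nu> (level_set \<nu> w t) = 1" if "t \<in> levels \<nu> w" for t
    using level_mass_pos[OF that]
    by (simp add: q_def level_mass_def emeasure_eq_measure inverse_ennreal ennreal_mult[symmetric])
  have sets: "sets (slice_kernel \<nu> w x) = sets \<nu>" for x
    by (simp add: slice_kernel_def)
  have sec [measurable]: "layer_density q x \<in> borel_measurable \<nu>" if "x \<in> space \<nu>" for x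
    using measurable_compose[OF measurable_Pair1'[OF that] layer_density_measurable[OF q]] by simp
  have one: "(\<integral>\<^sup>+y. layer_density q x y / ennreal (w x) \<partial>\<nu>) = 1" if x: "x \<in> space \<nu>" for x
  proof -
    have "(\<integral>\<^sup>+y. layer_density q x y \<partial>\<nu>) = (\<integral>\<^sup>+t. (if 0 < t \<and> t < w x then 1 else 0) \<partial>lborel)"
      unfolding layer_density_mass[OF q]
      using x by (intro nn_integral_cong) (auto simp: q_mass[OF in_levels])
    then show ?thesis
      using x w_pos[OF x] by (simp add: nn_integral_divide nn_integral_below_weight ennreal_divide_self)
  qed
  have "emeasure (slice_kernel \<nu> w x) A =
      (\<integral>\<^sup>+y\<in>A. layer_density q x y / ennreal (w x) \<partial>\<nu>)
        + indicator A x * (1 - (\<integral>\<^sup>+y. layer_density q x y / ennreal (w x) \<partial>\<nu>))"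
    if x: "x \<in> space \<nu>" and A [measurable]: "A \<in> sets \<nu>" for x A
  proof -
    have "(\<integral>\<^sup>+t\<in>{0<..<w x}. emeasure (level_measure \<nu> w t) A \<partial>lborel) =
        (\<integral>\<^sup>+t. (if 0 < t \<and> t < w x
          then q t * (\<integral>\<^sup>+y. indicator A y * indicator (level_set \<nu> w t) y \<partial>\<nu>) else 0) \<partial>lborel)"
    proof (rule nn_integral_cong)
      fix t
      have "(\<integral>\<^sup>+y. indicator A y * indicator (level_set \<nu> w t) y \<partial>\<nu>) = emeasure \<nu> (level_set \<nu> w t \<inter> A)"
        by (simp add: indicator_inter_arith[symmetric] Int_commute)
      then show "emeasure (level_measure \<nu> w t) A * indicator {0<..<w x} t =
          (if 0 < t \<and> t < w x then q t * (\<integral>\<^sup>+y. indicator A y * indicator (level_set \<nu> w t) y \<partial>\<nu>) else 0)"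
        by (simp add: level_measure_def q_def divide_ennreal_def mult.commute)
    qed
    also have "\<dots> = (\<integral>\<^sup>+y. indicator A y * layer_density q x y \<partial>\<nu>)"
      by (rule nn_integral_layer_density[symmetric]) measurable
    finally have "(\<integral>\<^sup>+t\<in>{0<..<w x}. emeasure (level_measure \<nu> w t) A \<partial>lborel) / ennreal (w x) =
        (\<integral>\<^sup>+y. indicator A y * layer_density q x y / ennreal (w x) \<partial>\<nu>)"
      using x by (simp add: nn_integral_divide)
    also have "\<dots> = (\<integral>\<^sup>+y\<in>A. layer_density q x y / ennreal (w x) \<partial>\<nu>)"
      by (simp add: divide_ennreal_def mult_ac)
    finally show ?thesis
      by (simp add: emeasure_slice_kernel[OF prob_space_axioms w_measurable A] one[OF x])
  qed
  note * = layer_kernel[OF q eq_refl[OF q_mass] sets this f]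
  show "0 \<le> dirichlet_form (target \<nu> w) (slice_kernel \<nu> w) f"
    by (rule *(1))
  show "ennreal (2 * c * dirichlet_form (target \<nu> w) (slice_kernel \<nu> w) f) =
      (\<integral>\<^sup>+t. indicator {0<..} t * (inverse (emeasure \<nu> (level_set \<nu> w t)) * level_energy f t) \<partial>lborel)"
    using *(2) unfolding q_def .
qed

section \<open>Comparison of the two Dirichlet forms\<close>

text \<open>Beyond the supremum the inverse level mass is infinite; the zero energy makes its
  product with that infinity 0.\<close>

lemma level_energy_eq_0:
  assumes "0 < t" "t \<notin> levels \<nu> w"
  shows "level_energy f t = 0"
proof -
  have "(\<integral>\<^sup>+y. (if t < w x \<and> t < w y then ennreal ((f x - f y)\<^sup>2) else 0) \<partial>\<nu>) = 0"
    if "x \<in> space \<nu>" for x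
  proof -
    have "\<not> t < w x" using in_levels[OF assms(1) _ that] assms(2) by blast
    then show ?thesis by simp
  qed
  then show ?thesis
    by (simp add: level_energy_def cong: nn_integral_cong)
qed

lemma level_energy_le_osc:
  assumes [measurable]: "f \<in> borel_measurable \<nu>" and t: "t \<in> levels \<nu> w"
  shows "level_energy f t / ennreal (level_mass \<nu> w t) / ennreal (level_mass \<nu> w t)
    \<le> e2ennreal ((osc (target \<nu> w) f)\<^sup>2) / 2"
proof -
  let ?G = "level_set \<nu> w t" and ?m = "ennreal (level_mass \<nu> w t)"
  let ?F = "\<lambda>x y. ennreal ((f x - f y)\<^sup>2)"
  have m: "emeasure \<nu> ?G = ?m"
    by (simp add: level_mass_def emeasure_eq_measure)
  have [measurable_cong]: "sets (level_measure \<nu> w t) = sets \<nu>"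
    by (simp add: level_measure_def)
  have "level_energy f t = (\<integral>\<^sup>+x. (\<integral>\<^sup>+y. ?F x y * indicator ?G y \<partial>\<nu>) * indicator ?G x \<partial>\<nu>)"
    unfolding level_energy_def
  proof (rule nn_integral_cong)
    fix x assume x: "x \<in> space \<nu>"
    show "(\<integral>\<^sup>+y. (if t < w x \<and> t < w y then ?F x y else 0) \<partial>\<nu>) =
        (\<integral>\<^sup>+y. ?F x y * indicator ?G y \<partial>\<nu>) * indicator ?G x"
      using x by (cases "t < w x") (auto simp: level_set_def indicator_def intro!: nn_integral_cong)
  qed
  then have "level_energy f t / ?m = (\<integral>\<^sup>+x. (\<integral>\<^sup>+y. ?F x y * indicator ?G y \<partial>\<nu>) * indicator ?G x / ?m \<partial>\<nu>)"
    by (simp add: nn_integral_divide)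
  \<comment> \<open>Each division by the level mass normalises one copy of \<open>\<nu>\<close>; the
    inner one has to stand inside the outer indicator to match an iterated integral over uniform
    measures.\<close>
  also have "\<dots> = (\<integral>\<^sup>+x. (\<integral>\<^sup>+y. ?F x y * indicator ?G y \<partial>\<nu>) / ?m * indicator ?G x \<partial>\<nu>)"
    by (simp add: divide_ennreal_def mult_ac)
  finally have "level_energy f t / ?m / ?m =
      (\<integral>\<^sup>+x. (\<integral>\<^sup>+y. ?F x y * indicator ?G y \<partial>\<nu>) / ?m * indicator ?G x \<partial>\<nu>) / ?m"
    by simp
  also have "\<dots> = (\<integral>\<^sup>+x. \<integral>\<^sup>+y. ?F x y \<partial>level_measure \<nu> w t \<partial>level_measure \<nu> w t)"
    unfolding level_measure_def by (simp add: nn_integral_uniform_measure m)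
  also have "\<dots> \<le> e2ennreal ((osc (target \<nu> w) f)\<^sup>2) / 2"
  proof (rule nn_integral_square_diff_le_osc_AE)
    show "prob_space (level_measure \<nu> w t)"
      using t by (rule prob_space_level_measure)
    show "AE x in level_measure \<nu> w t. Q x" if "AE x in target \<nu> w. Q x" for Q
      using that unfolding AE_target level_measure_def
      by (intro AE_uniform_measureI) auto
  qed simp_all
  finally show ?thesis .
qed

lemma level_energy_bound:
  assumes [measurable]: "f \<in> borel_measurable \<nu>" and t: "t \<in> levels \<nu> w" and s: "0 < s"
  shows "inverse (emeasure \<nu> (level_set \<nu> w t)) * level_energy f t \<le>
    ennreal s * level_energy f t + e2ennreal ((osc (target \<nu> w) f)\<^sup>2) / 2 *
      ennreal (indicator {0<..<1 / level_mass \<nu> w t} s * level_mass \<nu> w t)"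
proof -
  let ?m = "level_mass \<nu> w t" and ?O = "e2ennreal ((osc (target \<nu> w) f)\<^sup>2)"
  have m: "0 < ?m" using t by (rule level_mass_pos)
  have inv: "inverse (emeasure \<nu> (level_set \<nu> w t)) = ennreal (1 / ?m)"
    using m by (simp add: emeasure_eq_measure level_mass_def[symmetric] inverse_ennreal inverse_eq_divide)
  show ?thesis
  proof (cases "s < 1 / ?m")
    case False
    then have "ennreal (1 / ?m) * level_energy f t \<le> ennreal s * level_energy f t"
      by (intro mult_right_mono ennreal_leI) auto
    then show ?thesis
      unfolding inv by (rule order_trans) simp
  next
    case True
    \<comment> \<open>Writing \<open>1 / m\<close> as \<open>m * (1 / m^2)\<close> produces the
      normalised energy; the factor left over is the weight \<open>m\<close> in the remainder
      integral.\<close>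
    have "ennreal (1 / ?m) * level_energy f t = ennreal ?m * (level_energy f t / ennreal ?m / ennreal ?m)"
    proof -
      have "ennreal (1 / ?m) = ennreal ?m * inverse (ennreal ?m) * inverse (ennreal ?m)"
        using m by (simp add: inverse_ennreal ennreal_mult[symmetric] inverse_eq_divide)
      then show ?thesis by (simp add: divide_ennreal_def mult_ac)
    qed
    also have "\<dots> \<le> ennreal ?m * (?O / 2)"
      using t by (intro mult_left_mono level_energy_le_osc) auto
    also have "\<dots> = ?O / 2 * ennreal (indicator {0<..<1 / ?m} s * ?m)"
      using True s by (simp add: mult.commute)
    finally show ?thesis
      unfolding inv by (rule order_trans) simp
  qed
qed

lemma metropolis_le_slice:
  assumes f: "f \<in> L2 (target \<nu> w)"
  shows "dirichlet_form (target \<nu> w) (metropolis_kernel \<nu> w) f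
    \<le> dirichlet_form (target \<nu> w) (slice_kernel \<nu> w) f"
proof -
  have "1 * level_energy f t \<le> inverse (emeasure \<nu> (level_set \<nu> w t)) * level_energy f t" for t
  proof (rule mult_right_mono)
    show "1 \<le> inverse (emeasure \<nu> (level_set \<nu> w t))"
    \<comment> \<open>For a null level set the inverse is infinite and the bound still
      holds.\<close>
    proof (cases "level_mass \<nu> w t = 0")
      case False
      then show ?thesis
        by (simp add: level_mass_def emeasure_eq_measure inverse_ennreal zero_less_measure_iff one_le_inverse)
    qed (simp add: level_mass_def emeasure_eq_measure)
  qed simp
  then have "ennreal (2 * c * dirichlet_form (target \<nu> w) (metropolis_kernel \<nu> w) f)
      \<le> ennreal (2 * c * dirichlet_form (target \<nu> w) (slice_kernel \<nu> w) f)"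
    unfolding metropolis_dirichlet_form(2)[OF f] slice_dirichlet_form(2)[OF f]
    by (intro nn_integral_mono mult_left_mono) auto
  then show ?thesis
    using slice_dirichlet_form(1)[OF f] normalizer_pos by (simp add: ennreal_le_iff)
qed

lemma levels_measurable [measurable]: "levels \<nu> w \<in> sets borel"
  unfolding levels_def by measurable

lemma level_mass_measurable [measurable]: "level_mass \<nu> w \<in> borel_measurable borel"
  unfolding level_mass_def[abs_def] measure_def by measurable

text \<open>Layer-cake formula for the mean of \<open>w\<close>. It dominates the remainder, whose
  Bochner integral is therefore the true value rather than the default 0 of a non-integrable
  function.\<close>

lemma nn_integral_level_mass:
  "(\<integral>\<^sup>+t. indicator {0<..} t * ennreal (level_mass \<nu> w t) \<partial>lborel) = ennreal c"
proof -
  have "(\<integral>\<^sup>+t. indicator {0<..} t * ennreal (level_mass \<nu> w t) \<partial>lborel) =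
      (\<integral>\<^sup>+t. \<integral>\<^sup>+x. (if 0 < t \<and> t < w x then 1 else 0) \<partial>\<nu> \<partial>lborel)"
  proof (rule nn_integral_cong)
    fix t
    have "(\<integral>\<^sup>+x. (if 0 < t \<and> t < w x then 1 else 0) \<partial>\<nu>) =
        (\<integral>\<^sup>+x. indicator {0<..} t * indicator (level_set \<nu> w t) x \<partial>\<nu>)"
      by (intro nn_integral_cong) (auto simp: level_set_def)
    also have "\<dots> = indicator {0<..} t * ennreal (level_mass \<nu> w t)"
      by (simp add: nn_integral_cmult level_mass_def emeasure_eq_measure)
    finally show "indicator {0<..} t * ennreal (level_mass \<nu> w t) =
        (\<integral>\<^sup>+x. (if 0 < t \<and> t < w x then 1 else 0) \<partial>\<nu>)" ..
  qed
  also have "\<dots> = (\<integral>\<^sup>+x. \<integral>\<^sup>+t. (if 0 < t \<and> t < w x then 1 else 0) \<partial>lborel \<partial>\<nu>)"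
    by (rule nu_lborel.Fubini') measurable
  also have "\<dots> = (\<integral>\<^sup>+x. ennreal (w x) \<partial>\<nu>)"
    by (intro nn_integral_cong nn_integral_below_weight)
  also have "\<dots> = ennreal c"
    unfolding normalizer_def using w_integrable w_pos
    by (intro nn_integral_eq_integral AE_I2) (auto intro!: less_imp_le)
  finally show ?thesis .
qed

lemma slice_le_metropolis:
  assumes f: "f \<in> L2 (target \<nu> w)" and s: "0 < s"
  shows "ereal (dirichlet_form (target \<nu> w) (slice_kernel \<nu> w) f)
    \<le> ereal (s * dirichlet_form (target \<nu> w) (metropolis_kernel \<nu> w) f)
      + (osc (target \<nu> w) f)\<^sup>2 / ereal (4 * c)
        * ereal (LBINT t:levels \<nu> w. indicator {0<..<1 / level_mass \<nu> w t} s * level_mass \<nu> w t)"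
proof -
  let ?\<pi> = "target \<nu> w"
  let ?D = "\<lambda>P. dirichlet_form ?\<pi> P f" and ?O = "e2ennreal ((osc ?\<pi> f)\<^sup>2)"
  let ?U = "slice_kernel \<nu> w" and ?M = "metropolis_kernel \<nu> w"
  let ?i = "\<lambda>t. indicator {0<..<1 / level_mass \<nu> w t} s * level_mass \<nu> w t"
  let ?I = "LBINT t:levels \<nu> w. ?i t"
  have [measurable]: "f \<in> borel_measurable \<nu>" and f\<pi>: "f \<in> borel_measurable ?\<pi>"
    using f by (simp_all add: L2_def cong: measurable_cong_sets)
  \<comment> \<open>The indicator of an interval depending on \<open>t\<close> is replaced by a
    comparison, whose measurability in \<open>t\<close> is automatic.\<close>
  have "?i t = (if s < 1 / level_mass \<nu> w t then level_mass \<nu> w t else 0)" for t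
    using s by auto
  then have i_meas [measurable]: "?i \<in> borel_measurable borel"
    by simp
  have i_nonneg: "0 \<le> ?i t" for t
    by (simp add: level_mass_def)
  have nonneg: "0 \<le> ?D ?U" "0 \<le> ?D ?M" "0 \<le> ?I"
    using f i_nonneg unfolding set_lebesgue_integral_def
    by (auto intro!: slice_dirichlet_form metropolis_dirichlet_form Bochner_Integration.integral_nonneg)
  have I: "(\<integral>\<^sup>+t. ennreal (indicator (levels \<nu> w) t *\<^sub>R ?i t) \<partial>lborel) = ennreal ?I"
    unfolding set_lebesgue_integral_def
  proof (rule nn_integral_eq_integral)
    show "integrable lborel (\<lambda>t. indicator (levels \<nu> w) t *\<^sub>R ?i t)"
    proof (rule integrableI_bounded)
      have "(\<integral>\<^sup>+t. ennreal (norm (indicator (levels \<nu> w) t *\<^sub>R ?i t)) \<partial>lborel)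
          \<le> (\<integral>\<^sup>+t. indicator {0<..} t * ennreal (level_mass \<nu> w t) \<partial>lborel)"
        by (intro nn_integral_mono) (auto simp: indicator_def levels_def level_mass_def)
      also have "\<dots> < \<infinity>" by (simp add: nn_integral_level_mass)
      finally show "(\<integral>\<^sup>+t. ennreal (norm (indicator (levels \<nu> w) t *\<^sub>R ?i t)) \<partial>lborel) < \<infinity>" .
    qed measurable
  qed (use i_nonneg in auto)
  have "ennreal (2 * c * ?D ?U) \<le> (\<integral>\<^sup>+t. ennreal s * (indicator {0<..} t * level_energy f t)
      + ?O / 2 * ennreal (indicator (levels \<nu> w) t *\<^sub>R ?i t) \<partial>lborel)"
    unfolding slice_dirichlet_form(2)[OF f]
  proof (rule nn_integral_mono)
    fix t :: real
    show "indicator {0<..} t * (inverse (emeasure \<nu> (level_set \<nu> w t)) * level_energy f t)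
        \<le> ennreal s * (indicator {0<..} t * level_energy f t)
          + ?O / 2 * ennreal (indicator (levels \<nu> w) t *\<^sub>R ?i t)"
    proof (cases "0 < t \<and> t \<in> levels \<nu> w")
      case True
      then show ?thesis
        using level_energy_bound[of f t s] s by simp
    next
      case False
      \<comment> \<open>For \<open>t <= 0\<close> the indicator is 0; for positive \<open>t\<close>
        outside the levels the energy is.\<close>
      then show ?thesis by (cases "0 < t") (auto simp: level_energy_eq_0)
    qed
  qed
  also have "\<dots> = (\<integral>\<^sup>+t. ennreal s * (indicator {0<..} t * level_energy f t) \<partial>lborel)
      + (\<integral>\<^sup>+t. ?O / 2 * ennreal (indicator (levels \<nu> w) t *\<^sub>R ?i t) \<partial>lborel)"
    by (rule nn_integral_add) measurable
  also have "\<dots> = ennreal s * ennreal (2 * c * ?D ?M) + ?O / 2 * ennreal ?I"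
    unfolding metropolis_dirichlet_form(2)[OF f] I[symmetric]
    by (subst (1 2) nn_integral_cmult) simp_all
  finally have main: "ennreal (2 * c * ?D ?U) \<le> ennreal s * ennreal (2 * c * ?D ?M) + ?O / 2 * ennreal ?I" .
  show ?thesis
  proof (rule osc_square_cases[OF f\<pi>])
    assume inf: "(osc ?\<pi> f)\<^sup>2 = \<infinity>"
    show ?thesis
    \<comment> \<open>With infinite oscillation, a zero integral removes the remainder in both
      number types by \<open>0 * \<infinity> = 0\<close>, and a positive one makes the right-hand
      side infinite.\<close>
    proof (cases "?I = 0")
      case True
      then have "ennreal (2 * c * ?D ?U) \<le> ennreal (s * (2 * c * ?D ?M))"
        using main s by (simp add: ennreal_mult')
      then have "2 * c * ?D ?U \<le> 2 * c * (s * ?D ?M)"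
        using nonneg s normalizer_pos by (simp add: ennreal_le_iff mult_ac)
      then have "?D ?U \<le> s * ?D ?M"
        using normalizer_pos by simp
      then show ?thesis using True by (simp add: zero_ereal_def[symmetric])
    next
      case False
      then show ?thesis
        using nonneg normalizer_pos by (simp add: inf)
    qed
  next
    fix a b assume ab: "(osc ?\<pi> f)\<^sup>2 = ereal ((b - a)\<^sup>2)"
    have "?O / 2 = ennreal ((b - a)\<^sup>2 / 2)"
      using divide_ennreal[of "(b - a)\<^sup>2" 2] by (simp add: ab e2ennreal_ereal)
    then have "ennreal (2 * c * ?D ?U) \<le> ennreal (s * (2 * c * ?D ?M)) + ennreal ((b - a)\<^sup>2 / 2 * ?I)"
      using main s nonneg normalizer_pos by (simp only: ennreal_mult'[symmetric] ennreal_mult''[symmetric])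
    also have "\<dots> = ennreal (s * (2 * c * ?D ?M) + (b - a)\<^sup>2 / 2 * ?I)"
      using s nonneg normalizer_pos by (intro ennreal_plus[symmetric]) auto
    finally have "ennreal (2 * c * ?D ?U) \<le> ennreal (s * (2 * c * ?D ?M) + (b - a)\<^sup>2 / 2 * ?I)" .
    then have "2 * c * ?D ?U \<le> s * (2 * c * ?D ?M) + (b - a)\<^sup>2 / 2 * ?I"
      using s nonneg normalizer_pos by (subst (asm) ennreal_le_iff) auto
    then have "?D ?U \<le> s * ?D ?M + (b - a)\<^sup>2 / (4 * c) * ?I"
      using normalizer_pos by (simp add: field_simps)
    then show ?thesis
      using normalizer_pos by (simp add: ab)
  qed
qed

end

theorem proposition27:
  fixes \<nu> :: "'a measure" and w :: "'a \<Rightarrow> real"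
  assumes "prob_space \<nu>"
    and "w \<in> borel_measurable \<nu>"
    and "\<forall>x\<in>space \<nu>. 0 < w x"
    and "integrable \<nu> w"
    and "0 < normalizer \<nu> w"
    and "sup_weight \<nu> w = esssup \<nu> (\<lambda>x. ereal (w x))"
  shows "(\<forall>t\<in>levels \<nu> w.
            weak_poincare (restrict_space (level_measure \<nu> w t) (level_set \<nu> w t))
              (level_kernel \<nu> w t)
              (\<lambda>s. 1 / 4 * indicator {0<..<1 / level_mass \<nu> w t} s))
       \<and> (\<forall>s>0. \<forall>f\<in>L2_0 (target \<nu> w).
            dirichlet_form (target \<nu> w) (metropolis_kernel \<nu> w) f
              \<le> dirichlet_form (target \<nu> w) (slice_kernel \<nu> w) f
          \<and> ereal (dirichlet_form (target \<nu> w) (slice_kernel \<nu> w) f)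
              \<le> ereal (s * dirichlet_form (target \<nu> w) (metropolis_kernel \<nu> w) f)
                + (osc (target \<nu> w) f)\<^sup>2 / ereal (4 * normalizer \<nu> w)
                  * ereal (LBINT t:levels \<nu> w.
                      indicator {0<..<1 / level_mass \<nu> w t} s * level_mass \<nu> w t))"
proof -
  interpret weighted_prob_space \<nu> w
    using assms by (intro weighted_prob_space.intro weighted_prob_space_axioms.intro) auto
  show ?thesis
    using weak_poincare_level_kernel metropolis_le_slice slice_le_metropolis
    by (auto simp: L2_0_def)
qed

end
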